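(* Let $\alpha_1,\dots,\alpha_k>0$ with $\sum_{i=1}^k\alpha_i=1$ be a fixed allocation, and let design $i$ receive $N_i=N_i(n)$ of the first $n$ samples, with $\sum_i N_i=n$ and $N_i/n\to\alpha_i$ as $n\to\infty$ (i.e. design $i$ receives the proportion $\alpha_i$ of the budget). Then, almost surely, the Bayesian probability of correct selection $PCS^n_B$ satisfies $$-\lim_{n\to\infty}\frac1n\log\left(1-PCS^n_B\right)=\min_{i\neq i^*}\mathcal V_i(\alpha_i,\alpha_{i^*}),$$ where $$\mathcal V_i(\alpha_i,\alpha_{i^*})=\min_{\phi\in\mathbb R}\left(\frac{\alpha_i}{2}\log\left(1+\frac{(\mu_i-\phi)^2}{\sigma_i^2}\right)+\frac{\alpha_{i^*}}{2}\log\left(1+\frac{(\mu_{i^*}-\phi)^2}{\sigma_{i^*}^2}\right)\right).$$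
   Context: Setting: there are $k\ge2$ designs with fixed true means $\mu_i\in\mathbb R$ and variances $\sigma_i^2>0$, $i=1,\dots,k$. The observations $X_{i,l}\sim\mathcal N(\mu_i,\sigma_i^2)$, $l=1,2,\dots$, are independent across all $i$ and $l$. The best design $i^*=\arg\max_i\mu_i$ is unique. Prior: $\pi^0(\boldsymbol\phi,\boldsymbol\psi)$ is a probability density on $\mathbb R^k\times\mathbb R_+^k$ (integrating to 1; $\boldsymbol\phi$ stands for possible means, $\boldsymbol\psi$ for possible variances) such that (a) $\pi^0\le\bar c$ everywhere for some constant $\bar c>0$; (b) for some $\underline c>0$ and some $0<\bar\epsilon<\sigma_{\min}^2/2$, $\pi^0\ge\underline c$ on $$H_w=[\mu_{\min}-\bar\epsilon,\mu_{\max}+\bar\epsilon]^k\times[\sigma_{\min}^2-\bar\epsilon,\ \sigma_{\max}^2+\bar\epsilon+(\mu_{\max}-\mu_{\min}+2\bar\epsilon)^2]^k,$$ where $\mu_{\min},\mu_{\max}$ (resp. $\sigma^2_{\min},\sigma^2_{\max}$) are the smallest and largest true means (resp. variances). The prior may have dependence across designs. Posterior: $\pi^n(\boldsymbol\phi,\boldsymbol\psi)\propto\pi^0(\boldsymbol\phi,\boldsymbol\psi)\prod_{i=1}^k\prod_{l=1}^{N_i}f(X_{i,l}\mid\phi_i,\psi_i)$, normalized to integrate to 1, where $f(\cdot\mid\phi_i,\psi_i)$ is the $\mathcal N(\phi_i,\psi_i)$ density ($\psi_i$ is the variance). The posterior mean is $\hat\mu_i^n=\int\int\phi_i\,\pi^n(\boldsymbol\phi,\boldsymbol\psi)\,d\boldsymbol\psi\,d\boldsymbol\phi$,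 and $i^{*,n}=\arg\max_i\hat\mu_i^n$. The Bayesian probability of correct selection is $$PCS_B^n=\int_{\mathbb R^k}\int_{\mathbb R_+^k}\mathbf 1\{\phi_{i^{*,n}}>\phi_i\ \text{for all } i\ne i^{*,n}\}\,\pi^n(\boldsymbol\phi,\boldsymbol\psi)\,d\boldsymbol\psi\,d\boldsymbol\phi .$$ The true parameters $(\mu_i,\sigma_i^2)$ are treated as fixed; probability statements refer to the randomness of the observations. *)

theory Defs
  imports "HOL-Probability.Probability"
begin

text \<open>
  The finite type \<open>'k\<close> indexes the designs. A parameter is a pair \<open>(\<phi>, \<psi>)\<close> of a vector of
  candidate means and a vector of candidate variances; \<open>\<psi> $ i\<close> is a variance, whereas
  \<^const>\<open>normal_density\<close> expects a standard deviation.
\<close>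

type_synonym 'k param = "(real ^ 'k) \<times> (real ^ 'k)"

definition param_space :: "'k::finite param set" where
  "param_space = UNIV \<times> {\<psi>. \<forall>i. 0 < \<psi> $ i}"

definition prior_core :: "real ^ 'k::finite \<Rightarrow> real ^ 'k \<Rightarrow> real \<Rightarrow> 'k param set" where
  "prior_core \<mu> v \<epsilon> = {(\<phi>, \<psi>).
     (\<forall>i. \<phi> $ i \<in> {(MIN j. \<mu> $ j) - \<epsilon> .. (MAX j. \<mu> $ j) + \<epsilon>}) \<and>
     (\<forall>i. \<psi> $ i \<in> {(MIN j. v $ j) - \<epsilon> ..
                    (MAX j. v $ j) + \<epsilon> + ((MAX j. \<mu> $ j) - (MIN j. \<mu> $ j) + 2 * \<epsilon>)\<^sup>2})}"

text \<open>
  Below, \<open>N i\<close> is the number of samples of design \<open>i\<close> and \<open>x i l\<close> is its observation number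
  \<open>l + 1\<close>, so that the data consist of all \<open>x i l\<close> with \<open>l < N i\<close>.
\<close>

definition likelihood ::
    "('k::finite \<Rightarrow> nat) \<Rightarrow> ('k \<Rightarrow> nat \<Rightarrow> real) \<Rightarrow> 'k param \<Rightarrow> real" where
  "likelihood N x \<theta> =
     (\<Prod>i\<in>UNIV. \<Prod>l<N i. normal_density (fst \<theta> $ i) (sqrt (snd \<theta> $ i)) (x i l))"

definition posterior ::
    "('k::finite param \<Rightarrow> real) \<Rightarrow> ('k \<Rightarrow> nat) \<Rightarrow> ('k \<Rightarrow> nat \<Rightarrow> real) \<Rightarrow> 'k param \<Rightarrow> real" where
  "posterior \<pi>0 N x \<theta> =
     \<pi>0 \<theta> * likelihood N x \<theta> / (LINT \<theta>':param_space|lborel. \<pi>0 \<theta>' * likelihood N x \<theta>')"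

definition posterior_mean ::
    "('k::finite param \<Rightarrow> real) \<Rightarrow> ('k \<Rightarrow> nat) \<Rightarrow> ('k \<Rightarrow> nat \<Rightarrow> real) \<Rightarrow> 'k \<Rightarrow> real" where
  "posterior_mean \<pi>0 N x i = (LINT \<theta>:param_space|lborel. fst \<theta> $ i * posterior \<pi>0 N x \<theta>)"

text \<open>Ties between posterior means are broken by an arbitrary fixed choice.\<close>

definition selected_design ::
    "('k::finite param \<Rightarrow> real) \<Rightarrow> ('k \<Rightarrow> nat) \<Rightarrow> ('k \<Rightarrow> nat \<Rightarrow> real) \<Rightarrow> 'k" where
  "selected_design \<pi>0 N x = arg_max (posterior_mean \<pi>0 N x) (\<lambda>_. True)"

definition PCS_B ::
    "('k::finite param \<Rightarrow> real) \<Rightarrow> ('k \<Rightarrow> nat) \<Rightarrow> ('k \<Rightarrow> nat \<Rightarrow> real) \<Rightarrow> real" where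
  "PCS_B \<pi>0 N x =
     (let s = selected_design \<pi>0 N x in
      LINT \<theta>:param_space|lborel.
        indicator {\<theta>. \<forall>i. i \<noteq> s \<longrightarrow> fst \<theta> $ i < fst \<theta> $ s} \<theta> * posterior \<pi>0 N x \<theta>)"

definition rate_objective ::
    "real ^ 'k \<Rightarrow> real ^ 'k \<Rightarrow> 'k::finite \<Rightarrow> 'k \<Rightarrow> real \<Rightarrow> real \<Rightarrow> real \<Rightarrow> real" where
  "rate_objective \<mu> v b i a\<^sub>i a\<^sub>b \<phi> =
     a\<^sub>i / 2 * ln (1 + (\<mu> $ i - \<phi>)\<^sup>2 / v $ i) + a\<^sub>b / 2 * ln (1 + (\<mu> $ b - \<phi>)\<^sup>2 / v $ b)"

text \<open>
  \<open>rate \<mu> v b i a\<^sub>i a\<^sub>b\<close> is \<open>\<V>\<^sub>i(a\<^sub>i, a\<^sub>b)\<close> with best design \<open>b\<close>. The infimum is a minimum, see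
  \<open>rate_is_min\<close> below.
\<close>

definition rate ::
    "real ^ 'k \<Rightarrow> real ^ 'k \<Rightarrow> 'k::finite \<Rightarrow> 'k \<Rightarrow> real \<Rightarrow> real \<Rightarrow> real" where
  "rate \<mu> v b i a\<^sub>i a\<^sub>b = (INF \<phi>. rate_objective \<mu> v b i a\<^sub>i a\<^sub>b \<phi>)"

lemma rate_is_min:
  fixes \<mu> v :: "real ^ 'k::finite"
  assumes a: "0 \<le> a\<^sub>i" "0 \<le> a\<^sub>b" and v: "\<And>j. 0 < v $ j"
  shows "\<exists>\<phi>. rate \<mu> v b i a\<^sub>i a\<^sub>b = rate_objective \<mu> v b i a\<^sub>i a\<^sub>b \<phi>"
    and "rate \<mu> v b i a\<^sub>i a\<^sub>b \<le> rate_objective \<mu> v b i a\<^sub>i a\<^sub>b \<phi>"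
proof -
  let ?g = "rate_objective \<mu> v b i a\<^sub>i a\<^sub>b"
  define lo where "lo = min (\<mu> $ i) (\<mu> $ b)"
  define hi where "hi = max (\<mu> $ i) (\<mu> $ b)"
  have pos: "1 + (\<mu> $ j - \<phi>)\<^sup>2 / v $ j > 0" for j \<phi>
    using v[of j] by (simp add: add_pos_nonneg)
  have "continuous_on {lo..hi} ?g"
    unfolding rate_objective_def
    by (intro continuous_intros) (use v pos in \<open>force simp: less_le\<close>)+
  moreover have "{lo..hi} \<noteq> {}"
    by (auto simp: lo_def hi_def)
  ultimately obtain \<phi>\<^sub>0 where \<phi>\<^sub>0: "\<And>\<phi>. \<phi> \<in> {lo..hi} \<Longrightarrow> ?g \<phi>\<^sub>0 \<le> ?g \<phi>"
    using continuous_attains_inf[of "{lo..hi}" ?g] compact_Icc by blast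
  have min: "?g \<phi>\<^sub>0 \<le> ?g \<phi>" for \<phi>
  proof -
    define \<phi>' where "\<phi>' = max lo (min hi \<phi>)"
    have term_le: "ln (1 + (\<mu> $ j - \<phi>')\<^sup>2 / v $ j) \<le> ln (1 + (\<mu> $ j - \<phi>)\<^sup>2 / v $ j)"
      if "lo \<le> \<mu> $ j" "\<mu> $ j \<le> hi" for j
    proof -
      have "\<bar>\<mu> $ j - \<phi>'\<bar> \<le> \<bar>\<mu> $ j - \<phi>\<bar>"
        using that by (auto simp: \<phi>'_def)
      then have "(\<mu> $ j - \<phi>')\<^sup>2 \<le> (\<mu> $ j - \<phi>)\<^sup>2"
        by (simp add: abs_le_square_iff)
      then have "1 + (\<mu> $ j - \<phi>')\<^sup>2 / v $ j \<le> 1 + (\<mu> $ j - \<phi>)\<^sup>2 / v $ j"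
        using v[of j] by (simp add: divide_right_mono)
      with pos[of j \<phi>'] show ?thesis by simp
    qed
    have "?g \<phi>' \<le> ?g \<phi>"
      unfolding rate_objective_def
      by (intro add_mono mult_left_mono term_le) (use a in \<open>auto simp: lo_def hi_def\<close>)
    moreover have "\<phi>' \<in> {lo..hi}"
      by (auto simp: \<phi>'_def lo_def hi_def)
    ultimately show ?thesis using \<phi>\<^sub>0 by (meson order_trans)
  qed
  have eq: "rate \<mu> v b i a\<^sub>i a\<^sub>b = ?g \<phi>\<^sub>0"
    unfolding rate_def by (intro cInf_eq_minimum) (use min in auto)
  show "\<exists>\<phi>. rate \<mu> v b i a\<^sub>i a\<^sub>b = ?g \<phi>" using eq by blast
  show "rate \<mu> v b i a\<^sub>i a\<^sub>b \<le> ?g \<phi>" using eq min by simp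
qed

end

theory Submission
  imports Defs "HOL-Real_Asymp.Real_Asymp"
begin

text \<open>
  Relative to its value at the empirical means and variances, the likelihood at \<open>(\<phi>, \<psi>)\<close> is
  \<open>exp (- n K)\<close>, where \<open>K\<close> is the sum of the Kullback-Leibler divergences of the fitted normal
  distributions from the candidate ones, weighted by the sampling proportions. Optimising over the
  variances, each divergence is at least \<open>ln (1 + (m - \<phi>)\<^sup>2 / s) / 2\<close>, with equality at
  \<open>\<psi> = s + (m - \<phi>)\<^sup>2\<close>.

  By the strong law of large numbers the empirical parameters converge to the true ones, so Laplace's
  method applies. The normalising constant is \<open>exp (o(n))\<close>, because the prior charges every
  neighbourhood of the truth. The posterior means are consistent, so the best design is eventually
  selected. The posterior mass of the misordered parameters decays at least at the rate
  given by the infimum of \<open>K\<close> over them; pushing the two misordered means to a common value in between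
  only decreases \<open>K\<close>, which leaves the one-dimensional minimum defining the rate. The decay is no
  faster, by the mass near a slight perturbation of the minimiser.
\<close>

section \<open>A strong law of large numbers\<close>

text \<open>Monotonicity pins \<open>S n\<close> between its values at the two squares enclosing
  \<open>n\<close>, and the ratio of consecutive squares tends to 1. A strong law thus has to be
  proved only along the squares, where variance bounds are summable.\<close>

lemma square_subsequence_average:
  fixes S :: "nat \<Rightarrow> real"
  assumes mono: "mono S" and nonneg: "0 \<le> S 0"
    and lim: "(\<lambda>k. S (k\<^sup>2) / real (k\<^sup>2)) \<longlonglongrightarrow> m"
  shows "(\<lambda>n. S n / real n) \<longlonglongrightarrow> m"
proof -
  define r where "r n = nat \<lfloor>sqrt (real n)\<rfloor>" for n
  \<comment> \<open>For positive \<open>k\<close> these are \<open>S (k^2) / (k+1)^2\<close> and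
    \<open>S ((k+1)^2) / k^2\<close>, each written as a convergent average times a factor tending to
    1.\<close>
  define lo where "lo k = S (k\<^sup>2) / real (k\<^sup>2) * (real k / real (Suc k))\<^sup>2" for k
  define up where "up k = S ((Suc k)\<^sup>2) / real ((Suc k)\<^sup>2) * (real (Suc k) / real k)\<^sup>2" for k
  have S0: "0 \<le> S n" for n
    using nonneg monoD[OF mono, of 0 n] by simp
  have r: "(r n)\<^sup>2 \<le> n" "n \<le> (Suc (r n))\<^sup>2" for n
  proof -
    have a: "real (r n) \<le> sqrt (real n)" "sqrt (real n) \<le> real (Suc (r n))"
      by (auto simp: r_def) linarith
    have "(real (r n))\<^sup>2 \<le> real n" using power_mono[OF a(1), of 2] by simp
    then show "(r n)\<^sup>2 \<le> n" by (metis of_nat_le_iff of_nat_power)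
    have "real n \<le> (real (Suc (r n)))\<^sup>2" using power_mono[OF a(2), of 2] by simp
    then show "n \<le> (Suc (r n))\<^sup>2" by (metis of_nat_le_iff of_nat_power)
  qed
  have r_lim: "filterlim r at_top sequentially"
    unfolding r_def
    by (intro filterlim_compose[OF filterlim_nat_sequentially]
        filterlim_compose[OF filterlim_floor_sequentially]
        filterlim_compose[OF sqrt_at_top] filterlim_real_sequentially)
  have q1: "(\<lambda>k. (real k / real (Suc k))\<^sup>2) \<longlonglongrightarrow> 1" by real_asymp
  have q2: "(\<lambda>k. (real (Suc k) / real k)\<^sup>2) \<longlonglongrightarrow> 1" by real_asymp
  have "lo \<longlonglongrightarrow> m" unfolding lo_def using tendsto_mult[OF lim q1] by simp
  then have lo: "(\<lambda>n. lo (r n)) \<longlonglongrightarrow> m" by (rule filterlim_compose[OF _ r_lim])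
  have "up \<longlonglongrightarrow> m" unfolding up_def using tendsto_mult[OF LIMSEQ_Suc[OF lim] q2] by simp
  then have up: "(\<lambda>n. up (r n)) \<longlonglongrightarrow> m" by (rule filterlim_compose[OF _ r_lim])
  have ev: "\<forall>\<^sub>F n in sequentially. 1 \<le> r n"
    using r_lim by (simp add: filterlim_at_top)
  show ?thesis
  proof (rule tendsto_sandwich[OF _ _ lo up])
    show "\<forall>\<^sub>F n in sequentially. lo (r n) \<le> S n / real n"
      using ev
    proof eventually_elim
      case (elim n)
      have n: "0 < real n" using elim r(1)[of n] by (cases n) auto
      have "lo (r n) = S ((r n)\<^sup>2) / (real (Suc (r n)))\<^sup>2"
        using elim by (simp add: lo_def field_simps)
      also have "\<dots> \<le> S n / real n"
      proof (rule frac_le[OF S0 _ n])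
        show "S ((r n)\<^sup>2) \<le> S n" by (rule monoD[OF mono r(1)])
        show "real n \<le> (real (Suc (r n)))\<^sup>2" using r(2)[of n] by (metis of_nat_le_iff of_nat_power)
      qed
      finally show ?case .
    qed
    show "\<forall>\<^sub>F n in sequentially. S n / real n \<le> up (r n)"
      using ev
    proof eventually_elim
      case (elim n)
      have "S n / real n \<le> S ((Suc (r n))\<^sup>2) / (real (r n))\<^sup>2"
      proof (rule frac_le[OF S0])
        show "S n \<le> S ((Suc (r n))\<^sup>2)" by (rule monoD[OF mono r(2)])
        show "0 < (real (r n))\<^sup>2" using elim by simp
        show "(real (r n))\<^sup>2 \<le> real n" using r(1)[of n] by (metis of_nat_le_iff of_nat_power)
      qed
      also have "\<dots> = up (r n)"
        using elim by (simp add: up_def field_simps del: of_nat_Suc)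
      finally show ?case .
    qed
  qed
qed

text \<open>The centred average over the first \<open>k^2\<close> terms has second moment at most
  \<open>V / k^2\<close>. This is summable, so the squares of these averages almost surely form a
  convergent series and tend to 0. Nonnegativity makes the partial sums monotone, which fills the
  gaps between squares.\<close>

lemma (in prob_space) strong_law_nonneg_uncorrelated:
  fixes Y :: "nat \<Rightarrow> 'a \<Rightarrow> real"
  assumes meas[measurable]: "\<And>l. random_variable borel (Y l)"
    and nonneg: "\<And>l \<omega>. 0 \<le> Y l \<omega>"
    and square_integrable: "\<And>l. integrable M (\<lambda>\<omega>. (Y l \<omega>)\<^sup>2)"
    and variance: "\<And>l. expectation (\<lambda>\<omega>. (Y l \<omega> - m)\<^sup>2) \<le> V"
    and uncorrelated: "\<And>i j. i \<noteq> j \<Longrightarrow> expectation (\<lambda>\<omega>. (Y i \<omega> - m) * (Y j \<omega> - m)) = 0"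
  shows "AE \<omega> in M. (\<lambda>n. (\<Sum>l<n. Y l \<omega>) / real n) \<longlonglongrightarrow> m"
proof -
  define Z where "Z n \<omega> = (\<Sum>l<n. Y l \<omega> - m)" for n \<omega>
  have [measurable]: "Z n \<in> borel_measurable M" for n unfolding Z_def by measurable
  have intY: "integrable M (Y l)" for l
    by (rule square_integrable_imp_integrable[OF _ square_integrable]) auto
  have sq': "integrable M (\<lambda>\<omega>. (Y l \<omega> - m)\<^sup>2)" for l
    using square_integrable[of l] intY[of l] by (simp add: power2_diff)
  have int: "integrable M (\<lambda>\<omega>. (Y i \<omega> - m) * (Y j \<omega> - m))" for i j
  proof (rule Bochner_Integration.integrable_bound)
    show "integrable M (\<lambda>\<omega>. (Y i \<omega> - m)\<^sup>2 + (Y j \<omega> - m)\<^sup>2)" using sq' by simp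
    have *: "\<bar>a * b\<bar> \<le> a\<^sup>2 + b\<^sup>2" for a b :: real
    proof -
      have "0 \<le> \<bar>a\<bar> * \<bar>b\<bar>" by simp
      then show ?thesis using sum_squares_bound[of "\<bar>a\<bar>" "\<bar>b\<bar>"]
          unfolding abs_mult power2_abs by linarith
    qed
    show "AE \<omega> in M. norm ((Y i \<omega> - m) * (Y j \<omega> - m)) \<le> norm ((Y i \<omega> - m)\<^sup>2 + (Y j \<omega> - m)\<^sup>2)"
      using * by (auto simp: abs_mult)
  qed measurable
  have Zsq: "(Z n \<omega>)\<^sup>2 = (\<Sum>i<n. \<Sum>j<n. (Y i \<omega> - m) * (Y j \<omega> - m))" for n \<omega>
    by (simp add: Z_def power2_eq_square sum_product)
  have intZ: "integrable M (\<lambda>\<omega>. (Z n \<omega>)\<^sup>2)" for n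
    unfolding Zsq using int by simp
  have EZ: "expectation (\<lambda>\<omega>. (Z n \<omega>)\<^sup>2) \<le> real n * V" for n
  proof -
    have "expectation (\<lambda>\<omega>. (Z n \<omega>)\<^sup>2)
        = (\<Sum>i<n. \<Sum>j<n. expectation (\<lambda>\<omega>. (Y i \<omega> - m) * (Y j \<omega> - m)))"
      unfolding Zsq using int by (simp add: Bochner_Integration.integral_sum)
    also have "\<dots> = (\<Sum>i<n. \<Sum>j<n. if j = i then expectation (\<lambda>\<omega>. (Y i \<omega> - m)\<^sup>2) else 0)"
      using uncorrelated by (intro sum.cong) (auto simp: power2_eq_square)
    also have "\<dots> = (\<Sum>i<n. expectation (\<lambda>\<omega>. (Y i \<omega> - m)\<^sup>2))"
      by (simp add: sum.delta)
    also have "\<dots> \<le> (\<Sum>i<n. V)" by (rule sum_mono[OF variance])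
    finally show ?thesis by simp
  qed
  define u where "u k \<omega> = (Z (k\<^sup>2) \<omega> / real (k\<^sup>2))\<^sup>2" for k \<omega>
  have [measurable]: "u k \<in> borel_measurable M" for k unfolding u_def by measurable
  have u0: "0 \<le> u k \<omega>" for k \<omega> by (simp add: u_def)
  have intu: "integrable M (u k)" for k
    unfolding u_def power_divide using intZ by simp
  \<comment> \<open>At \<open>k = 0\<close> both sides are 0 because division by zero yields
    0.\<close>
  have Eu: "expectation (u k) \<le> V * (1 / real k ^ 2)" for k
  proof -
    have "expectation (u k) = expectation (\<lambda>\<omega>. (Z (k\<^sup>2) \<omega>)\<^sup>2) / (real (k\<^sup>2))\<^sup>2"
      unfolding u_def power_divide by simp
    also have "\<dots> \<le> real (k\<^sup>2) * V / (real (k\<^sup>2))\<^sup>2" by (intro divide_right_mono EZ) simp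
    also have "\<dots> = V * (1 / real k ^ 2)" by (simp add: power2_eq_square)
    finally show ?thesis .
  qed
  have summ: "summable (\<lambda>k. V * (1 / real k ^ 2))"
    using inverse_power_summable[of 2, where 'a=real] by (intro summable_mult) (simp add: inverse_eq_divide)
  have "summable (\<lambda>k. expectation (u k))"
    by (rule summable_comparison_test'[OF summ, of 0]) (use Eu u0 in \<open>auto intro!: integral_nonneg\<close>)
  then have fin: "(\<Sum>k. ennreal (expectation (u k))) \<noteq> \<top>"
    using u0 by (subst suminf_ennreal2) (auto intro!: integral_nonneg)
  have "(\<integral>\<^sup>+\<omega>. (\<Sum>k. ennreal (u k \<omega>)) \<partial>M) = (\<Sum>k. (\<integral>\<^sup>+\<omega>. ennreal (u k \<omega>) \<partial>M))"
    by (rule nn_integral_suminf) measurable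
  also have "\<dots> = (\<Sum>k. ennreal (expectation (u k)))"
    using intu u0 by (subst nn_integral_eq_integral) auto
  finally have "AE \<omega> in M. (\<Sum>k. ennreal (u k \<omega>)) \<noteq> \<infinity>"
    using fin by (intro nn_integral_PInf_AE) auto
  then show ?thesis
  proof eventually_elim
    case (elim \<omega>)
    have "summable (\<lambda>k. u k \<omega>)"
      using elim u0 by (intro summable_suminf_not_top) auto
    then have "(\<lambda>k. u k \<omega>) \<longlonglongrightarrow> 0" by (rule summable_LIMSEQ_zero)
    then have "(\<lambda>k. sqrt (u k \<omega>)) \<longlonglongrightarrow> 0" using tendsto_real_sqrt by fastforce
    then have "(\<lambda>k. Z (k\<^sup>2) \<omega> / real (k\<^sup>2)) \<longlonglongrightarrow> 0"
      by (intro tendsto_rabs_zero_cancel[of "\<lambda>k. Z (k\<^sup>2) \<omega> / real (k\<^sup>2)"])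
        (simp only: u_def real_sqrt_abs)
    then have 1: "(\<lambda>k. Z (k\<^sup>2) \<omega> / real (k\<^sup>2) + m) \<longlonglongrightarrow> m"
      using tendsto_add[OF _ tendsto_const] by fastforce
    have "(\<lambda>k. (\<Sum>l<k\<^sup>2. Y l \<omega>) / real (k\<^sup>2)) \<longlonglongrightarrow> m"
    proof (rule Lim_transform_eventually[OF 1])
      show "\<forall>\<^sub>F k in sequentially. Z (k\<^sup>2) \<omega> / real (k\<^sup>2) + m = (\<Sum>l<k\<^sup>2. Y l \<omega>) / real (k\<^sup>2)"
        using eventually_gt_at_top[of 0]
        by eventually_elim (simp add: Z_def sum_subtractf field_simps)
    qed
    then show ?case
      by (intro square_subsequence_average[where S="\<lambda>n. \<Sum>l<n. Y l \<omega>"])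
        (auto intro!: monoI sum_mono2 simp: nonneg)
  qed
qed

text \<open>Squaring makes the summands nonnegative, as the preceding law demands. The shift
  \<open>c\<close> is carried along so that the law for \<open>Z\<close> itself can be recovered by
  polarisation. The injection \<open>f\<close> extracts one sequence, later the samples of one
  design, from a jointly independent family.\<close>

lemma (in prob_space) strong_law_normal_square:
  fixes Z :: "'i \<Rightarrow> 'a \<Rightarrow> real" and f :: "nat \<Rightarrow> 'i"
  assumes indep: "indep_vars (\<lambda>_. borel) Z UNIV" and inj: "inj f"
    and normal: "\<And>l. distributed M lborel (Z (f l)) (normal_density \<mu> \<sigma>)" and "0 < \<sigma>"
  shows "AE \<omega> in M. (\<lambda>n. (\<Sum>l<n. (Z (f l) \<omega> + c)\<^sup>2) / real n) \<longlonglongrightarrow> \<sigma>\<^sup>2 + (\<mu> + c)\<^sup>2"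
proof -
  define m where "m = \<sigma>\<^sup>2 + (\<mu> + c)\<^sup>2"
  define d where "d = \<mu> + c"
  let ?f = "normal_density \<mu> \<sigma>"
  have [measurable]: "random_variable borel (Z i)" for i
    using indep by (simp add: indep_vars_def)
  have int_k: "integrable lborel (\<lambda>x. ?f x * (x - \<mu>) ^ k)" for k
    using integrable_normal_moment[OF \<open>0 < \<sigma>\<close>] .
  \<comment> \<open>The squares have finite variance by a fourth-moment argument: expanding
    \<open>(x - \<mu>) + d\<close> binomially leaves only central moments.\<close>
  have fourth: "integrable lborel (\<lambda>x. ?f x * ((x + c)\<^sup>2)\<^sup>2)"
  proof -
    have "?f x * ((x + c)\<^sup>2)\<^sup>2 = ?f x * (x - \<mu>) ^ 4 + 4 * d * (?f x * (x - \<mu>) ^ 3)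
      + 6 * d\<^sup>2 * (?f x * (x - \<mu>) ^ 2) + 4 * d ^ 3 * (?f x * (x - \<mu>) ^ 1) + d ^ 4 * (?f x * (x - \<mu>) ^ 0)" for x
      unfolding d_def by (simp add: power2_eq_square eval_nat_numeral) (simp add: algebra_simps)
    then show ?thesis
      by (simp only:) (intro Bochner_Integration.integrable_add integrable_mult_right int_k)
  qed
  have sq: "integrable M (\<lambda>\<omega>. ((Z (f l) \<omega> + c)\<^sup>2)\<^sup>2)" for l
    using fourth distributed_integrable[OF normal, of "\<lambda>x. ((x + c)\<^sup>2)\<^sup>2"] by simp
  have int2: "integrable M (\<lambda>\<omega>. (Z (f l) \<omega> + c)\<^sup>2)" for l
    by (rule square_integrable_imp_integrable[OF _ sq]) auto
  have mean: "expectation (\<lambda>\<omega>. (Z (f l) \<omega> + c)\<^sup>2) = m" for l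
  proof -
    have "(\<integral>x. ?f x * (x + c)\<^sup>2 \<partial>lborel)
        = (\<integral>x. ?f x * (x - \<mu>) ^ 2 + 2 * d * (?f x * (x - \<mu>) ^ 1) + d\<^sup>2 * (?f x * (x - \<mu>) ^ 0) \<partial>lborel)"
      by (intro Bochner_Integration.integral_cong refl)
        (simp add: d_def power2_eq_square algebra_simps)
    also have "\<dots> = (\<integral>x. ?f x * (x - \<mu>) ^ 2 \<partial>lborel) + 2 * d * (\<integral>x. ?f x * (x - \<mu>) ^ 1 \<partial>lborel)
        + d\<^sup>2 * (\<integral>x. ?f x * (x - \<mu>) ^ 0 \<partial>lborel)"
      using int_k[of 2] int_k[of 1] int_k[of 0] by simp
    also have "\<dots> = m"
      using integral_normal_moment_even[OF \<open>0 < \<sigma>\<close>, of \<mu> 1] integral_normal_moment_odd[OF \<open>0 < \<sigma>\<close>, of \<mu> 0] \<open>0 < \<sigma>\<close>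
      by (simp add: m_def d_def eval_nat_numeral)
    finally show ?thesis
      using distributed_integral[OF normal, of "\<lambda>x. (x + c)\<^sup>2"] by simp
  qed
  \<comment> \<open>The right-hand side does not depend on \<open>l\<close>, so it serves as the
    uniform variance bound \<open>V\<close>.\<close>
  have "expectation (\<lambda>\<omega>. ((Z (f l) \<omega> + c)\<^sup>2 - m)\<^sup>2) = (\<integral>x. ?f x * ((x + c)\<^sup>2 - m)\<^sup>2 \<partial>lborel)" for l
    using distributed_integral[OF normal, of "\<lambda>x. ((x + c)\<^sup>2 - m)\<^sup>2"] by simp
  moreover have "expectation (\<lambda>\<omega>. ((Z (f i) \<omega> + c)\<^sup>2 - m) * ((Z (f j) \<omega> + c)\<^sup>2 - m)) = 0"
    if "i \<noteq> j" for i j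
  proof -
    let ?W = "\<lambda>k \<omega>. (Z k \<omega> + c)\<^sup>2 - m"
    have ne: "f i \<noteq> f j" using inj that by (auto dest: injD)
    have "indep_vars (\<lambda>_. borel) ?W UNIV"
      by (rule indep_vars_compose2[OF indep]) auto
    then have ind: "indep_vars (\<lambda>_. borel) ?W {f i, f j}" by (rule indep_vars_subset) auto
    have "expectation (\<lambda>\<omega>. \<Prod>k\<in>{f i, f j}. ?W k \<omega>) = (\<Prod>k\<in>{f i, f j}. expectation (?W k))"
      by (rule indep_vars_lebesgue_integral[OF _ ind]) (use int2 in auto)
    moreover have "expectation (?W (f i)) = 0"
      using int2 mean by (simp add: prob_space)
    ultimately show ?thesis using ne by simp
  qed
  ultimately show ?thesis
    unfolding m_def[symmetric]
    by (intro strong_law_nonneg_uncorrelated[where Y="\<lambda>l \<omega>. (Z (f l) \<omega> + c)\<^sup>2"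
          and V="\<integral>x. ?f x * ((x + c)\<^sup>2 - m)\<^sup>2 \<partial>lborel"] sq) simp_all
qed

text \<open>Polarisation \<open>Z = ((Z + 1)^2 - Z^2 - 1) / 2\<close>: the shifts 0 and 1 of the
  squared law yield both limits.\<close>

lemma (in prob_space) strong_law_normal:
  fixes Z :: "'i \<Rightarrow> 'a \<Rightarrow> real" and f :: "nat \<Rightarrow> 'i"
  assumes indep: "indep_vars (\<lambda>_. borel) Z UNIV" and inj: "inj f"
    and normal: "\<And>l. distributed M lborel (Z (f l)) (normal_density \<mu> \<sigma>)" and "0 < \<sigma>"
  shows "AE \<omega> in M. (\<lambda>n. (\<Sum>l<n. Z (f l) \<omega>) / real n) \<longlonglongrightarrow> \<mu> \<and>
    (\<lambda>n. (\<Sum>l<n. (Z (f l) \<omega>)\<^sup>2) / real n) \<longlonglongrightarrow> \<sigma>\<^sup>2 + \<mu>\<^sup>2"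
  using strong_law_normal_square[OF assms, of 0] strong_law_normal_square[OF assms, of 1]
proof eventually_elim
  case (elim \<omega>)
  let ?A = "\<lambda>c n. (\<Sum>l<n. (Z (f l) \<omega> + c)\<^sup>2) / real n"
  have "(\<lambda>n. (?A 1 n - ?A 0 n - 1) / 2) \<longlonglongrightarrow> (\<sigma>\<^sup>2 + (\<mu> + 1)\<^sup>2 - (\<sigma>\<^sup>2 + (\<mu> + 0)\<^sup>2) - 1) / 2"
    by (intro tendsto_intros elim) simp
  moreover have "(\<sigma>\<^sup>2 + (\<mu> + 1)\<^sup>2 - (\<sigma>\<^sup>2 + (\<mu> + 0)\<^sup>2) - 1) / 2 = \<mu>"
    by (simp add: power2_eq_square algebra_simps)
  moreover have "\<forall>\<^sub>F n in sequentially. (?A 1 n - ?A 0 n - 1) / 2 = (\<Sum>l<n. Z (f l) \<omega>) / real n"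
    using eventually_gt_at_top[of 0]
    by eventually_elim (simp add: power2_sum sum.distrib sum_distrib_left[symmetric] field_simps)
  ultimately show ?case
    using elim(1) by (auto intro: Lim_transform_eventually)
qed

section \<open>Normal likelihoods and relative entropy\<close>

text \<open>The divergence KL(N(m, s) || N(\<phi>, \<psi>)), the second parameter of each
  distribution being a variance.\<close>

definition normal_KL :: "real \<Rightarrow> real \<Rightarrow> real \<Rightarrow> real \<Rightarrow> real" where
  "normal_KL m s \<phi> \<psi> = ln (\<psi> / s) / 2 + (s + (m - \<phi>)\<^sup>2) / (2 * \<psi>) - 1 / 2"

text \<open>With \<open>t = s + (m - \<phi>)^2\<close> the two sides differ by
  \<open>(t / \<psi> - 1 - ln (t / \<psi>)) / 2\<close>, which is nonnegative.\<close>

lemma normal_KL_ge: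
  assumes "0 < s" "0 < \<psi>"
  shows "ln (1 + (m - \<phi>)\<^sup>2 / s) / 2 \<le> normal_KL m s \<phi> \<psi>"
proof -
  define t where "t = s + (m - \<phi>)\<^sup>2"
  have t: "0 < t" unfolding t_def using assms by (simp add: add_pos_nonneg)
  have "ln (t / \<psi>) \<le> t / \<psi> - 1" using t assms by (intro ln_le_minus_one) simp
  moreover have "1 + (m - \<phi>)\<^sup>2 / s = t / s" using assms by (simp add: t_def field_simps)
  ultimately show ?thesis
    unfolding normal_KL_def t_def[symmetric] using t assms by (simp add: ln_div field_simps)
qed

lemma normal_KL_optimal_variance:
  assumes "0 < s"
  shows "normal_KL m s \<phi> (s + (m - \<phi>)\<^sup>2) = ln (1 + (m - \<phi>)\<^sup>2 / s) / 2"
proof -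
  have t: "s + (m - \<phi>)\<^sup>2 > 0" using assms by (simp add: add_pos_nonneg)
  then have "(s + (m - \<phi>)\<^sup>2) / (2 * (s + (m - \<phi>)\<^sup>2)) = 1 / 2" by simp
  then show ?thesis
    unfolding normal_KL_def using assms by (simp add: add_divide_distrib)
qed

section \<open>The likelihood in terms of sample statistics\<close>

text \<open>The squared deviations from \<open>\<phi>\<close> split into the spread about the sample
  mean and the offset of that mean, so the sample mean and variance are sufficient.\<close>

lemma prod_normal_density:
  fixes x :: "nat \<Rightarrow> real"
  assumes "0 < n" and "0 < \<psi>"
    and m: "m = (\<Sum>l<n. x l) / real n" and s: "s = (\<Sum>l<n. (x l)\<^sup>2) / real n - m\<^sup>2"
  shows "(\<Prod>l<n. normal_density \<phi> (sqrt \<psi>) (x l))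
    = exp (- real n * (ln (2 * pi * \<psi>) / 2 + (s + (m - \<phi>)\<^sup>2) / (2 * \<psi>)))"
proof -
  have "normal_density \<phi> (sqrt \<psi>) y = exp (- ((y - \<phi>)\<^sup>2 / (2 * \<psi>)) - ln (2 * pi * \<psi>) / 2)" for y
  proof -
    have "sqrt (2 * pi * \<psi>) = exp (ln (2 * pi * \<psi>) / 2)"
      using \<open>0 < \<psi>\<close> by (subst ln_sqrt[symmetric]) auto
    then show ?thesis
      using \<open>0 < \<psi>\<close> by (simp add: normal_density_def exp_diff)
  qed
  then have "(\<Prod>l<n. normal_density \<phi> (sqrt \<psi>) (x l))
      = exp (\<Sum>l<n. - ((x l - \<phi>)\<^sup>2 / (2 * \<psi>)) - ln (2 * pi * \<psi>) / 2)"
    by (simp add: exp_sum)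
  also have "(\<Sum>l<n. - ((x l - \<phi>)\<^sup>2 / (2 * \<psi>)) - ln (2 * pi * \<psi>) / 2)
      = - (\<Sum>l<n. (x l - \<phi>)\<^sup>2) / (2 * \<psi>) - real n * (ln (2 * pi * \<psi>) / 2)"
    by (simp add: sum_subtractf sum_negf sum_divide_distrib)
  also have "(\<Sum>l<n. (x l - \<phi>)\<^sup>2) = real n * (s + (m - \<phi>)\<^sup>2)"
  proof -
    have "(\<Sum>l<n. (x l - \<phi>)\<^sup>2) = (\<Sum>l<n. (x l)\<^sup>2) - 2 * \<phi> * (\<Sum>l<n. x l) + real n * \<phi>\<^sup>2"
      by (simp add: power2_diff sum.distrib sum_subtractf sum_distrib_left algebra_simps)
    also have "(\<Sum>l<n. x l) = real n * m" using m assms by simp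
    also have "(\<Sum>l<n. (x l)\<^sup>2) = real n * (s + m\<^sup>2)" using s assms by simp
    finally show ?thesis by (simp add: power2_eq_square algebra_simps)
  qed
  finally show ?thesis by (simp add: algebra_simps)
qed

text \<open>The variance carries the maximum-likelihood normalisation \<open>1 / N i\<close>, which
  makes log-likelihood ratios exact divergences. The pair is typed as a parameter so that the
  likelihood can be evaluated at it.\<close>

definition sample_stats :: "('k::finite \<Rightarrow> nat) \<Rightarrow> ('k \<Rightarrow> nat \<Rightarrow> real) \<Rightarrow> 'k param" where
  "sample_stats N x =
    (\<chi> i. (\<Sum>l<N i. x i l) / real (N i),
     \<chi> i. (\<Sum>l<N i. (x i l)\<^sup>2) / real (N i) - ((\<Sum>l<N i. x i l) / real (N i))\<^sup>2)"

definition weighted_KL :: "real ^ 'k \<Rightarrow> 'k param \<Rightarrow> 'k::finite param \<Rightarrow> real" where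
  "weighted_KL a p \<theta> = (\<Sum>j\<in>UNIV. a $ j * normal_KL (fst p $ j) (snd p $ j) (fst \<theta> $ j) (snd \<theta> $ j))"

lemma likelihood_pos:
  assumes "\<And>i. 0 < snd \<theta> $ i"
  shows "0 < likelihood N x \<theta>"
  unfolding likelihood_def using assms by (intro prod_pos ballI normal_density_pos) simp

text \<open>An exact identity, with no asymptotic error. The factor
  \<open>likelihood N x (sample_stats N x)\<close> is free of \<open>\<theta>\<close> and cancels on
  normalising the posterior.\<close>

lemma likelihood_eq_weighted_KL:
  fixes N :: "'k::finite \<Rightarrow> nat"
  assumes N: "\<And>i. 0 < N i" and s: "\<And>i. 0 < snd (sample_stats N x) $ i"
    and \<theta>: "\<theta> \<in> param_space" and "0 < n"
  shows "likelihood N x \<theta> = likelihood N x (sample_stats N x)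
    * exp (- real n * weighted_KL (\<chi> i. real (N i) / real n) (sample_stats N x) \<theta>)"
proof -
  let ?p = "sample_stats N x"
  have pos: "0 < snd \<theta> $ i" for i using \<theta> by (auto simp: param_space_def)
  have "(\<Prod>l<N i. normal_density (fst \<theta> $ i) (sqrt (snd \<theta> $ i)) (x i l))
    = (\<Prod>l<N i. normal_density (fst ?p $ i) (sqrt (snd ?p $ i)) (x i l))
      * exp (- real (N i) * normal_KL (fst ?p $ i) (snd ?p $ i) (fst \<theta> $ i) (snd \<theta> $ i))" for i
  proof -
    define m s where "m = fst ?p $ i" and "s = snd ?p $ i"
    have ms: "m = (\<Sum>l<N i. x i l) / real (N i)" "s = (\<Sum>l<N i. (x i l)\<^sup>2) / real (N i) - m\<^sup>2"
      by (simp_all add: m_def s_def sample_stats_def)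
    have "0 < s" using assms(2)[of i] by (simp add: s_def)
    have ln: "ln (2 * pi * snd \<theta> $ i) = ln (2 * pi * s) + ln (snd \<theta> $ i / s)"
      using pos[of i] \<open>0 < s\<close> by (simp add: ln_mult ln_div)
    have half: "(s + (m - m)\<^sup>2) / (2 * s) = 1 / 2" using \<open>0 < s\<close> by simp
    show ?thesis
      unfolding m_def[symmetric] s_def[symmetric] prod_normal_density[OF N pos ms]
        prod_normal_density[OF N \<open>0 < s\<close> ms] mult_exp_exp ln half normal_KL_def
      by (simp add: field_simps)
  qed
  then have "likelihood N x \<theta> = likelihood N x ?p
      * exp (\<Sum>i\<in>UNIV. - real (N i) * normal_KL (fst ?p $ i) (snd ?p $ i) (fst \<theta> $ i) (snd \<theta> $ i))"
    by (simp add: likelihood_def prod.distrib exp_sum)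
  also have "(\<Sum>i\<in>UNIV. - real (N i) * normal_KL (fst ?p $ i) (snd ?p $ i) (fst \<theta> $ i) (snd \<theta> $ i))
      = - real n * weighted_KL (\<chi> i. real (N i) / real n) ?p \<theta>"
    using \<open>0 < n\<close> by (simp add: weighted_KL_def sum_distrib_left sum_negf)
  finally show ?thesis .
qed

text \<open>Each divergence is bounded by its minimum over the variance, and the nonnegative terms
  outside \<open>J\<close> are dropped. Later \<open>J\<close> is empty for nonnegativity, a single
  design for the posterior mean, and a misordered pair for the rate.\<close>

lemma weighted_KL_ge:
  assumes "\<And>i. 0 \<le> a $ i" "\<And>i. 0 < snd p $ i" "\<theta> \<in> param_space"
  shows "(\<Sum>j\<in>J. a $ j / 2 * ln (1 + (fst p $ j - fst \<theta> $ j)\<^sup>2 / snd p $ j)) \<le> weighted_KL a p \<theta>"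
proof -
  have pos: "0 < snd \<theta> $ i" for i using assms by (auto simp: param_space_def)
  have t: "a $ j / 2 * ln (1 + (fst p $ j - fst \<theta> $ j)\<^sup>2 / snd p $ j)
      \<le> a $ j * normal_KL (fst p $ j) (snd p $ j) (fst \<theta> $ j) (snd \<theta> $ j)" for j
    using mult_left_mono[OF normal_KL_ge[OF assms(2)[of j] pos[of j], of "fst p $ j" "fst \<theta> $ j"] assms(1)[of j]]
    by simp
  have "(\<Sum>j\<in>J. a $ j / 2 * ln (1 + (fst p $ j - fst \<theta> $ j)\<^sup>2 / snd p $ j))
      \<le> (\<Sum>j\<in>UNIV. a $ j / 2 * ln (1 + (fst p $ j - fst \<theta> $ j)\<^sup>2 / snd p $ j))"
    using assms(1,2) by (intro sum_mono2) (auto simp: less_imp_le)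
  also have "\<dots> \<le> weighted_KL a p \<theta>"
    unfolding weighted_KL_def by (rule sum_mono[OF t])
  finally show ?thesis .
qed

lemma weighted_KL_nonneg:
  assumes "\<And>i. 0 \<le> a $ i" "\<And>i. 0 < snd p $ i" "\<theta> \<in> param_space"
  shows "0 \<le> weighted_KL a p \<theta>"
  using weighted_KL_ge[OF assms, of "{}"] by simp

text \<open>Joint continuity in weights, fitted parameter and candidate. The product filter provides
  a single neighbourhood \<open>V\<close> that works for all large \<open>n\<close>, the uniformity
  required by the lower Laplace bound.\<close>

lemma eventually_weighted_KL_less:
  assumes "\<And>i. 0 < snd p $ i" "\<And>i. 0 < snd \<theta> $ i" "weighted_KL a p \<theta> < r"
    and "b \<longlonglongrightarrow> a" "q \<longlonglongrightarrow> p"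
  obtains V where "open V" "\<theta> \<in> V"
    "\<forall>\<^sub>F n in sequentially. \<forall>\<theta>'\<in>V. weighted_KL (b n) (q n) \<theta>' < r"
proof -
  let ?F = "nhds (a, p) \<times>\<^sub>F nhds \<theta>"
  have 1: "((\<lambda>z. fst z) \<longlongrightarrow> (a, p)) ?F" "((\<lambda>z. snd z) \<longlongrightarrow> \<theta>) ?F"
    by (rule filterlim_fst filterlim_snd)+
  have "((\<lambda>z. weighted_KL (fst (fst z)) (snd (fst z)) (snd z)) \<longlongrightarrow> weighted_KL (fst (a, p)) (snd (a, p)) \<theta>) ?F"
    unfolding weighted_KL_def normal_KL_def
    by (intro tendsto_intros 1) (use assms(1,2) in \<open>auto simp: less_imp_neq[symmetric]\<close>)
  then have "\<forall>\<^sub>F z in ?F. weighted_KL (fst (fst z)) (snd (fst z)) (snd z) < r"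
    using assms(3) by (intro order_tendstoD(2)) auto
  then obtain Pf Pg where P: "eventually Pf (nhds (a, p))" "eventually Pg (nhds \<theta>)"
    "\<And>x y. Pf x \<Longrightarrow> Pg y \<Longrightarrow> weighted_KL (fst x) (snd x) y < r"
    by (auto simp: eventually_prod_filter)
  obtain V where V: "open V" "\<theta> \<in> V" "\<forall>y\<in>V. Pg y" using P(2) by (auto simp: eventually_nhds)
  have "(\<lambda>n. (b n, q n)) \<longlonglongrightarrow> (a, p)" by (intro tendsto_Pair assms)
  then have "\<forall>\<^sub>F n in sequentially. Pf (b n, q n)"
    by (rule eventually_compose_filterlim[OF P(1)])
  then have "\<forall>\<^sub>F n in sequentially. \<forall>\<theta>'\<in>V. weighted_KL (b n) (q n) \<theta>' < r"
    by eventually_elim (use P(3) V(3) in fastforce)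
  with V(1,2) that show ?thesis by blast
qed

lemma measurable_weighted_KL [measurable]: "weighted_KL a p \<in> borel_measurable borel"
proof -
  have [measurable]: "(\<lambda>\<theta>::'a param. fst \<theta> $ j) \<in> borel_measurable borel"
    "(\<lambda>\<theta>::'a param. snd \<theta> $ j) \<in> borel_measurable borel" for j
    by (intro borel_measurable_continuous_onI continuous_intros)+
  show ?thesis unfolding weighted_KL_def[abs_def] normal_KL_def[abs_def] by measurable
qed

lemma eventually_ln_quadratic_le:
  fixes m s :: "nat \<Rightarrow> real"
  assumes m: "m \<longlonglongrightarrow> \<mu>" and s: "s \<longlonglongrightarrow> v" and v: "0 < v" and \<eta>: "0 < \<eta>"
  shows "\<forall>\<^sub>F n in sequentially. \<forall>\<phi>. ln (1 + (\<mu> - \<phi>)\<^sup>2 / v) \<le> \<eta> + ln (1 + (m n - \<phi>)\<^sup>2 / s n)"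
proof -
  \<comment> \<open>Of the two factors of \<open>exp \<eta> = \<kappa> * \<kappa>\<close>, one pays
    for the shift of the centre and the other for the change of the variance.\<close>
  define \<kappa> where "\<kappa> = exp (\<eta> / 2)"
  have \<kappa>: "1 < \<kappa>" and K: "exp \<eta> = \<kappa> * \<kappa>"
    using \<eta> by (auto simp: \<kappa>_def mult_exp_exp)
  \<comment> \<open>Young's inequality; the gap between the two sides is a square divided by
    \<open>\<kappa> - 1\<close>.\<close>
  have quad: "(x + y)\<^sup>2 \<le> \<kappa> * x\<^sup>2 + \<kappa> / (\<kappa> - 1) * y\<^sup>2" for x y :: real
  proof -
    have "\<kappa> * x\<^sup>2 + \<kappa> / (\<kappa> - 1) * y\<^sup>2 - (x + y)\<^sup>2 = ((\<kappa> - 1) * x - y)\<^sup>2 / (\<kappa> - 1)"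
      using \<kappa> by (simp add: field_simps power2_eq_square)
    also have "\<dots> \<ge> 0" using \<kappa> by simp
    finally show ?thesis by simp
  qed
  have "(\<lambda>n. 1 + \<kappa> / (\<kappa> - 1) * (\<mu> - m n)\<^sup>2 / v) \<longlonglongrightarrow> 1 + \<kappa> / (\<kappa> - 1) * (\<mu> - \<mu>)\<^sup>2 / v"
    using v by (intro tendsto_intros m) auto
  then have e1: "\<forall>\<^sub>F n in sequentially. 1 + \<kappa> / (\<kappa> - 1) * (\<mu> - m n)\<^sup>2 / v < \<kappa> * \<kappa>"
    using \<kappa> by (intro order_tendstoD(2)) (auto simp: less_1_mult)
  have e2: "\<forall>\<^sub>F n in sequentially. s n < \<kappa> * v"
    using v \<kappa> by (intro order_tendstoD(2)[OF s]) auto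
  have e3: "\<forall>\<^sub>F n in sequentially. 0 < s n"
    using v by (intro order_tendstoD(1)[OF s]) auto
  from e1 e2 e3 show ?thesis
  proof eventually_elim
    case (elim n)
    show ?case
    proof
      fix \<phi>
      have "(\<mu> - \<phi>)\<^sup>2 \<le> \<kappa> * (m n - \<phi>)\<^sup>2 + \<kappa> / (\<kappa> - 1) * (\<mu> - m n)\<^sup>2"
        using quad[of "m n - \<phi>" "\<mu> - m n"] by simp
      then have "(\<mu> - \<phi>)\<^sup>2 / v \<le> (\<kappa> * (m n - \<phi>)\<^sup>2 + \<kappa> / (\<kappa> - 1) * (\<mu> - m n)\<^sup>2) / v"
        using v by (intro divide_right_mono) auto
      then have "1 + (\<mu> - \<phi>)\<^sup>2 / v \<le> (1 + \<kappa> / (\<kappa> - 1) * (\<mu> - m n)\<^sup>2 / v) + \<kappa> * (m n - \<phi>)\<^sup>2 / v"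
        by (simp add: add_divide_distrib)
      also have "\<kappa> * (m n - \<phi>)\<^sup>2 / v \<le> \<kappa> * \<kappa> * ((m n - \<phi>)\<^sup>2 / s n)"
      proof -
        have "\<kappa> * (m n - \<phi>)\<^sup>2 * s n \<le> \<kappa> * (m n - \<phi>)\<^sup>2 * (\<kappa> * v)"
          using elim \<kappa> by (intro mult_left_mono) auto
        then show ?thesis using elim v by (simp add: field_simps)
      qed
      finally have "1 + (\<mu> - \<phi>)\<^sup>2 / v \<le> exp \<eta> * (1 + (m n - \<phi>)\<^sup>2 / s n)"
        using elim by (simp add: K algebra_simps)
      moreover have "0 < 1 + (\<mu> - \<phi>)\<^sup>2 / v" "0 < 1 + (m n - \<phi>)\<^sup>2 / s n"
        using v elim by (auto simp: add_pos_nonneg)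
      ultimately have "ln (1 + (\<mu> - \<phi>)\<^sup>2 / v) \<le> ln (exp \<eta> * (1 + (m n - \<phi>)\<^sup>2 / s n))"
        by (subst ln_le_cancel_iff) (auto intro: mult_pos_pos)
      then show "ln (1 + (\<mu> - \<phi>)\<^sup>2 / v) \<le> \<eta> + ln (1 + (m n - \<phi>)\<^sup>2 / s n)"
        using \<open>0 < 1 + (m n - \<phi>)\<^sup>2 / s n\<close> by (simp add: ln_mult)
    qed
  qed
qed

section \<open>The one-dimensional minimum at which two means meet\<close>

lemma ln_quadratic_mono:
  fixes v :: real
  assumes "\<bar>x\<bar> \<le> \<bar>y\<bar>" "0 < v"
  shows "ln (1 + x\<^sup>2 / v) \<le> ln (1 + y\<^sup>2 / v)"
proof -
  have "x\<^sup>2 / v \<le> y\<^sup>2 / v" using assms by (simp add: divide_right_mono abs_le_square_iff)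
  moreover have "0 \<le> x\<^sup>2 / v" using assms by simp
  ultimately show ?thesis by simp
qed

text \<open>Clamping \<open>y\<close> to the interval from \<open>\<mu> $ i\<close> to
  \<open>\<mu> $ b\<close> gives a common value at least as close to \<open>\<mu> $ b\<close> as
  \<open>y\<close> and, because \<open>y \<le> x\<close>, at least as close to
  \<open>\<mu> $ i\<close> as \<open>x\<close>.\<close>

lemma rate_le_crossing:
  fixes \<mu> v :: "real ^ 'k::finite"
  assumes v: "\<And>j. 0 < v $ j" and a: "0 \<le> a\<^sub>i" "0 \<le> a\<^sub>b" and "\<mu> $ i \<le> \<mu> $ b" and "y \<le> x"
  shows "rate \<mu> v b i a\<^sub>i a\<^sub>b
    \<le> a\<^sub>i / 2 * ln (1 + (\<mu> $ i - x)\<^sup>2 / v $ i) + a\<^sub>b / 2 * ln (1 + (\<mu> $ b - y)\<^sup>2 / v $ b)"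
proof -
  define z where "z = max (\<mu> $ i) (min (\<mu> $ b) y)"
  have "rate \<mu> v b i a\<^sub>i a\<^sub>b \<le> rate_objective \<mu> v b i a\<^sub>i a\<^sub>b z"
    by (rule rate_is_min(2)[OF a v])
  also have "\<dots> \<le> a\<^sub>i / 2 * ln (1 + (\<mu> $ i - x)\<^sup>2 / v $ i) + a\<^sub>b / 2 * ln (1 + (\<mu> $ b - y)\<^sup>2 / v $ b)"
    unfolding rate_objective_def
    by (intro add_mono mult_left_mono ln_quadratic_mono v) (use assms in \<open>auto simp: z_def\<close>)
  finally show ?thesis .
qed

text \<open>Clamping a minimiser brings it closer to both means. Its location between them later
  keeps the perturbed minimiser inside the prior core.\<close>

lemma rate_attained_between:
  fixes \<mu> v :: "real ^ 'k::finite"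
  assumes v: "\<And>j. 0 < v $ j" and a: "0 \<le> a\<^sub>i" "0 \<le> a\<^sub>b" and "\<mu> $ i \<le> \<mu> $ b"
  obtains z where "\<mu> $ i \<le> z" "z \<le> \<mu> $ b" "rate \<mu> v b i a\<^sub>i a\<^sub>b = rate_objective \<mu> v b i a\<^sub>i a\<^sub>b z"
proof -
  obtain y where y: "rate \<mu> v b i a\<^sub>i a\<^sub>b = rate_objective \<mu> v b i a\<^sub>i a\<^sub>b y"
    using rate_is_min(1)[OF a v] by blast
  define z where "z = max (\<mu> $ i) (min (\<mu> $ b) y)"
  have "rate_objective \<mu> v b i a\<^sub>i a\<^sub>b z \<le> rate_objective \<mu> v b i a\<^sub>i a\<^sub>b y"
    unfolding rate_objective_def
    by (intro add_mono mult_left_mono ln_quadratic_mono v) (use assms in \<open>auto simp: z_def\<close>)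
  moreover have "rate \<mu> v b i a\<^sub>i a\<^sub>b \<le> rate_objective \<mu> v b i a\<^sub>i a\<^sub>b z"
    by (rule rate_is_min(2)[OF a v])
  ultimately show ?thesis
    using y assms(4) by (intro that[of z]) (auto simp: z_def)
qed

section \<open>Asymptotics of posterior masses\<close>

lemma interior_prior_coreI:
  fixes \<mu> v :: "real ^ 'k::finite"
  assumes "\<And>i. (MIN j. \<mu> $ j) - \<epsilon> < fst \<theta> $ i" "\<And>i. fst \<theta> $ i < (MAX j. \<mu> $ j) + \<epsilon>"
    and "\<And>i. (MIN j. v $ j) - \<epsilon> < snd \<theta> $ i"
    and "\<And>i. snd \<theta> $ i < (MAX j. v $ j) + \<epsilon> + ((MAX j. \<mu> $ j) - (MIN j. \<mu> $ j) + 2 * \<epsilon>)\<^sup>2"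
  shows "\<theta> \<in> interior (prior_core \<mu> v \<epsilon>)"
proof (rule interiorI)
  let ?S = "(\<Inter>i. {\<theta>. (MIN j. \<mu> $ j) - \<epsilon> < fst \<theta> $ i} \<inter> {\<theta>. fst \<theta> $ i < (MAX j. \<mu> $ j) + \<epsilon>}
      \<inter> {\<theta>. (MIN j. v $ j) - \<epsilon> < snd \<theta> $ i}
      \<inter> {\<theta>. snd \<theta> $ i < (MAX j. v $ j) + \<epsilon> + ((MAX j. \<mu> $ j) - (MIN j. \<mu> $ j) + 2 * \<epsilon>)\<^sup>2})"
  show "open ?S"
    by (intro open_INT open_Int open_Collect_less ballI finite continuous_intros)
  show "\<theta> \<in> ?S" using assms by auto
  show "?S \<subseteq> prior_core \<mu> v \<epsilon>"
    by (auto simp: prior_core_def intro: less_imp_le)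
qed

lemma prior_core_subset_param_space:
  fixes \<mu> v :: "real ^ 'k::finite"
  assumes "0 < \<epsilon>" "\<epsilon> < (MIN j. v $ j) / 2"
  shows "prior_core \<mu> v \<epsilon> \<subseteq> param_space"
proof -
  have "0 < (MIN j. v $ j) - \<epsilon>" using assms by linarith
  moreover have "(MIN j. v $ j) - \<epsilon> \<le> snd \<theta> $ i" if "\<theta> \<in> prior_core \<mu> v \<epsilon>" for \<theta> i
    using that by (auto simp: prior_core_def)
  ultimately have "0 < snd \<theta> $ i" if "\<theta> \<in> prior_core \<mu> v \<epsilon>" for \<theta> i
    using that less_le_trans by blast
  then show ?thesis by (auto simp: param_space_def)
qed

lemma weighted_KL_optimal_variance:
  assumes "\<And>i. 0 < snd p $ i"
  shows "weighted_KL a p (\<phi>, \<chi> j. snd p $ j + (fst p $ j - \<phi> $ j)\<^sup>2)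
    = (\<Sum>j\<in>UNIV. a $ j / 2 * ln (1 + (fst p $ j - \<phi> $ j)\<^sup>2 / snd p $ j))"
  using assms by (simp add: weighted_KL_def normal_KL_optimal_variance)

text \<open>A deterministic setting for one fixed sample path: \<open>a\<close> holds the sampling
  proportions, \<open>p\<close> the fitted parameters, and \<open>P\<close> the prior as a
  probability measure. The lower bound on the prior density is abstracted to
  \<open>support\<close>.\<close>

locale concentrating_posterior = prob_space P
  for P :: "'k::finite param measure" +
  fixes \<mu> v \<alpha> :: "real ^ 'k" and \<epsilon> :: real
    and a :: "nat \<Rightarrow> real ^ 'k" and p :: "nat \<Rightarrow> 'k param"
  assumes sets_P [measurable_cong]: "sets P = sets borel"
    and AE_param: "AE \<theta> in P. \<theta> \<in> param_space"
    and support: "\<And>U. open U \<Longrightarrow> U \<noteq> {} \<Longrightarrow> U \<subseteq> prior_core \<mu> v \<epsilon> \<Longrightarrow> 0 < measure P U"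
    and v_pos: "\<And>i. 0 < v $ i"
    and \<epsilon>: "0 < \<epsilon>" "\<epsilon> < (MIN j. v $ j) / 2"
    and \<alpha>_pos: "\<And>i. 0 < \<alpha> $ i" and \<alpha>_le: "\<And>i. \<alpha> $ i \<le> 1"
    and a_lim: "a \<longlonglongrightarrow> \<alpha>" and p_lim: "p \<longlonglongrightarrow> (\<mu>, v)"
begin

definition likelihood_ratio :: "nat \<Rightarrow> 'k param \<Rightarrow> real" where
  "likelihood_ratio n \<theta> = exp (- real n * weighted_KL (a n) (p n) \<theta>)"

text \<open>The unnormalised posterior mass of \<open>A\<close>, with the likelihood at the fitted
  parameter divided out.\<close>

definition mass :: "nat \<Rightarrow> 'k param set \<Rightarrow> real" where
  "mass n A = (\<integral>\<theta>. indicator A \<theta> * likelihood_ratio n \<theta> \<partial>P)"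

text \<open>Sets aside the early \<open>n\<close> at which a design is still unsampled or a fitted
  variance vanishes.\<close>

definition regular :: "nat \<Rightarrow> bool" where
  "regular n \<longleftrightarrow> 0 < n \<and> (\<forall>i. 0 < a n $ i) \<and> (\<forall>i. 0 < snd (p n) $ i)"

lemma component_limits:
  "(\<lambda>n. a n $ i) \<longlonglongrightarrow> \<alpha> $ i" "(\<lambda>n. fst (p n) $ i) \<longlonglongrightarrow> \<mu> $ i" "(\<lambda>n. snd (p n) $ i) \<longlonglongrightarrow> v $ i"
  using tendsto_vec_nth[OF a_lim, of i] tendsto_vec_nth[OF tendsto_fst[OF p_lim], of i]
    tendsto_vec_nth[OF tendsto_snd[OF p_lim], of i] by auto

lemma eventually_regular: "\<forall>\<^sub>F n in sequentially. regular n"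
proof -
  have "\<forall>\<^sub>F n in sequentially. \<forall>i. 0 < a n $ i"
    using order_tendstoD(1)[OF component_limits(1) \<alpha>_pos] by (intro eventually_all_finite) auto
  moreover have "\<forall>\<^sub>F n in sequentially. \<forall>i. 0 < snd (p n) $ i"
    using order_tendstoD(1)[OF component_limits(3) v_pos] by (intro eventually_all_finite) auto
  ultimately show ?thesis
    using eventually_gt_at_top[of 0] by eventually_elim (auto simp: regular_def)
qed

lemma measurable_likelihood_ratio [measurable]: "likelihood_ratio n \<in> borel_measurable borel"
  unfolding likelihood_ratio_def[abs_def] by measurable

lemma likelihood_ratio_le:
  assumes "r \<le> weighted_KL (a n) (p n) \<theta>"
  shows "likelihood_ratio n \<theta> \<le> exp (- real n * r)"
  using assms by (simp add: likelihood_ratio_def mult_left_mono)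

lemma likelihood_ratio_le_1:
  assumes "regular n" "\<theta> \<in> param_space"
  shows "likelihood_ratio n \<theta> \<le> 1"
  using likelihood_ratio_le[OF weighted_KL_nonneg, of n \<theta>] assms by (auto simp: regular_def less_imp_le)

lemma likelihood_ratio_pos: "0 < likelihood_ratio n \<theta>"
  by (simp add: likelihood_ratio_def)

lemma abs_likelihood_ratio [simp]: "\<bar>likelihood_ratio n \<theta>\<bar> = likelihood_ratio n \<theta>"
  by (simp add: likelihood_ratio_def)

lemma integrable_likelihood_ratio:
  assumes "regular n" "A \<in> sets borel"
  shows "integrable P (\<lambda>\<theta>. indicator A \<theta> * likelihood_ratio n \<theta>)"
proof (rule integrable_const_bound[where B=1])
  show "AE \<theta> in P. norm (indicator A \<theta> * likelihood_ratio n \<theta>) \<le> 1"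
    using AE_param
    by eventually_elim
      (use likelihood_ratio_le_1[OF assms(1)] likelihood_ratio_pos in \<open>auto simp: indicator_def less_imp_le\<close>)
  show "(\<lambda>\<theta>. indicator A \<theta> * likelihood_ratio n \<theta>) \<in> borel_measurable P"
    using assms(2) by measurable
qed

text \<open>The upper half of Laplace's method: \<open>P\<close> has total mass 1, so a bound on the
  integrand over \<open>A\<close> bounds the integral.\<close>

lemma mass_upper:
  assumes n: "regular n" and A: "A \<in> sets borel"
    and r: "\<And>\<theta>. \<theta> \<in> A \<Longrightarrow> \<theta> \<in> param_space \<Longrightarrow> r \<le> weighted_KL (a n) (p n) \<theta>"
  shows "mass n A \<le> exp (- real n * r)"
proof -
  have "mass n A \<le> (\<integral>\<theta>. exp (- real n * r) \<partial>P)"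
    unfolding mass_def
  proof (rule integral_mono_AE[OF integrable_likelihood_ratio[OF n A]])
    show "AE \<theta> in P. indicator A \<theta> * likelihood_ratio n \<theta> \<le> exp (- real n * r)"
      using AE_param
    proof eventually_elim
      case (elim \<theta>)
      then show ?case using likelihood_ratio_le[OF r, of \<theta>] by (cases "\<theta> \<in> A") auto
    qed
  qed simp
  then show ?thesis by (simp add: prob_space)
qed

lemma mass_UNIV_le:
  assumes "regular n"
  shows "mass n UNIV \<le> 1"
proof -
  have "0 \<le> weighted_KL (a n) (p n) \<theta>" if "\<theta> \<in> param_space" for \<theta>
    using weighted_KL_nonneg[OF _ _ that] assms by (auto simp: regular_def less_imp_le)
  then show ?thesis using mass_upper[of n UNIV 0] assms by simp
qed

text \<open>The lower half of Laplace's method. Near \<open>\<theta>\<close> the divergence stays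
  below some \<open>r' < r\<close> on an open set of positive prior measure; this fixed measure
  eventually exceeds \<open>exp ((r' - r) * n)\<close> and so costs no more than the gap between
  \<open>r'\<close> and \<open>r\<close>.\<close>

lemma mass_lower:
  assumes A: "A \<in> sets borel" and U: "open U" "U \<subseteq> A"
    and \<theta>: "\<theta> \<in> U" "\<theta> \<in> interior (prior_core \<mu> v \<epsilon>)"
    and r: "weighted_KL \<alpha> (\<mu>, v) \<theta> < r"
  shows "\<forall>\<^sub>F n in sequentially. exp (- real n * r) \<le> mass n A"
proof -
  obtain r' where r': "weighted_KL \<alpha> (\<mu>, v) \<theta> < r'" "r' < r" using dense[OF r] by blast
  have "\<theta> \<in> param_space"
    using \<theta>(2) interior_subset prior_core_subset_param_space[OF \<epsilon>] by blast
  then have "0 < snd \<theta> $ i" for i by (auto simp: param_space_def)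
  then obtain V where V: "open V" "\<theta> \<in> V"
    "\<forall>\<^sub>F n in sequentially. \<forall>\<theta>'\<in>V. weighted_KL (a n) (p n) \<theta>' < r'"
    using eventually_weighted_KL_less[of "(\<mu>, v)" \<theta> \<alpha> r' a p] v_pos r'(1) a_lim p_lim by auto
  \<comment> \<open>The three factors keep the set inside \<open>A\<close>, the divergence below
    \<open>r'\<close>, and the prior measure positive.\<close>
  define W where "W = U \<inter> V \<inter> interior (prior_core \<mu> v \<epsilon>)"
  have W: "open W" "\<theta> \<in> W" "W \<subseteq> prior_core \<mu> v \<epsilon>" "W \<subseteq> V" "W \<subseteq> A"
    using U V \<theta> interior_subset by (auto simp: W_def)
  then have c: "0 < measure P W" by (intro support) auto
  have [measurable]: "W \<in> sets borel" using W(1) by simp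
  have "filterlim (\<lambda>n. (r' - r) * real n) at_bot sequentially"
    using r'(2) by (intro filterlim_tendsto_neg_mult_at_bot[OF tendsto_const] filterlim_real_sequentially) simp
  then have "(\<lambda>n. exp ((r' - r) * real n)) \<longlonglongrightarrow> 0"
    by (rule filterlim_compose[OF exp_at_bot])
  then have "\<forall>\<^sub>F n in sequentially. exp ((r' - r) * real n) < measure P W"
    using c by (rule order_tendstoD(2))
  with V(3) eventually_regular show ?thesis
  proof eventually_elim
    case (elim n)
    have "exp (- real n * r) = exp (- real n * r') * exp ((r' - r) * real n)"
      by (simp add: mult_exp_exp algebra_simps)
    also have "\<dots> \<le> exp (- real n * r') * measure P W"
      using elim by (intro mult_left_mono) auto
    also have "\<dots> = (\<integral>\<theta>. indicator W \<theta> * exp (- real n * r') \<partial>P)"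
      by (simp add: sets_eq_imp_space_eq[OF sets_P])
    also have "\<dots> \<le> mass n A"
      unfolding mass_def
    proof (rule integral_mono_AE[OF _ integrable_likelihood_ratio[OF _ A]])
      show "AE \<theta> in P. indicator W \<theta> * exp (- real n * r') \<le> indicator A \<theta> * likelihood_ratio n \<theta>"
      proof (rule AE_I2)
        fix \<theta>
        show "indicator W \<theta> * exp (- real n * r') \<le> indicator A \<theta> * likelihood_ratio n \<theta>"
        proof (cases "\<theta> \<in> W")
          case True
          then have "weighted_KL (a n) (p n) \<theta> \<le> r'" using elim W(4) by (auto intro: less_imp_le)
          then show ?thesis using True W(5) by (auto simp: likelihood_ratio_def mult_left_mono)
        qed (auto simp: likelihood_ratio_pos less_imp_le)
      qed
      show "integrable P (\<lambda>\<theta>. indicator W \<theta> * exp (- real n * r'))"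
        by (intro integrable_mult_left integrable_real_indicator) (auto simp: emeasure_eq_measure)
    qed (use elim in simp)
    finally show ?case .
  qed
qed

lemma truth_in_interior: "(\<mu>, v) \<in> interior (prior_core \<mu> v \<epsilon>)"
proof (rule interior_prior_coreI)
  fix i
  have "(MIN j. \<mu> $ j) \<le> \<mu> $ i" "(MIN j. v $ j) \<le> v $ i" by (auto intro: Min_le)
  moreover have "\<mu> $ i \<le> (MAX j. \<mu> $ j)" "v $ i \<le> (MAX j. v $ j)" by (auto intro: Max_ge)
  moreover have "0 \<le> ((MAX j. \<mu> $ j) - (MIN j. \<mu> $ j) + 2 * \<epsilon>)\<^sup>2" by simp
  ultimately show "(MIN j. \<mu> $ j) - \<epsilon> < fst (\<mu>, v) $ i" "fst (\<mu>, v) $ i < (MAX j. \<mu> $ j) + \<epsilon>"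
    "(MIN j. v $ j) - \<epsilon> < snd (\<mu>, v) $ i"
    "snd (\<mu>, v) $ i < (MAX j. v $ j) + \<epsilon> + ((MAX j. \<mu> $ j) - (MIN j. \<mu> $ j) + 2 * \<epsilon>)\<^sup>2"
    using \<epsilon>(1) unfolding fst_conv snd_conv by linarith+
qed

text \<open>The divergence vanishes at the truth, which is interior to the prior core, so the
  normalising constant has exponential rate 0.\<close>

lemma mass_UNIV_lower:
  assumes "0 < \<delta>"
  shows "\<forall>\<^sub>F n in sequentially. exp (- real n * \<delta>) \<le> mass n UNIV"
proof (rule mass_lower[of _ UNIV "(\<mu>, v)"])
  have "weighted_KL \<alpha> (\<mu>, v) (\<mu>, v) = 0"
    using v_pos by (auto simp: weighted_KL_def normal_KL_def less_imp_neq[symmetric])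
  then show "weighted_KL \<alpha> (\<mu>, v) (\<mu>, v) < \<delta>" using assms by simp
qed (auto simp: truth_in_interior)

section \<open>Consistency of the posterior means\<close>

text \<open>No moment of the prior is needed: one factor \<open>(1 + (m - \<phi>)\<^sup>2 / s) powr (-1/2)\<close> of the
  likelihood ratio already absorbs the growth of \<open>\<bar>\<phi> - m\<bar>\<close>.\<close>

lemma deviation_likelihood_ratio_le:
  assumes n: "regular n" "1 \<le> real n * a n $ i" and \<theta>: "\<theta> \<in> param_space" and \<eta>: "0 < \<eta>"
  shows "\<bar>fst \<theta> $ i - fst (p n) $ i\<bar> * likelihood_ratio n \<theta> \<le> \<eta> * likelihood_ratio n \<theta>
    + sqrt (snd (p n) $ i) * exp (- (real n * a n $ i - 1) / 2 * ln (1 + \<eta>\<^sup>2 / snd (p n) $ i))"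
    (is "?d * _ \<le> _ + ?B")
proof (cases "?d \<le> \<eta>")
  case True
  then have "?d * likelihood_ratio n \<theta> \<le> \<eta> * likelihood_ratio n \<theta>"
    by (intro mult_right_mono) (auto simp: likelihood_ratio_pos less_imp_le)
  moreover have "0 \<le> ?B" using n by (auto simp: regular_def less_imp_le)
  ultimately show ?thesis by linarith
next
  case False
  define s where "s = snd (p n) $ i"
  define q where "q = 1 + (fst (p n) $ i - fst \<theta> $ i)\<^sup>2 / s"
  have s: "0 < s" using n by (simp add: regular_def s_def)
  have q: "1 \<le> q" using s by (simp add: q_def)
  have "?d\<^sup>2 \<le> s * q" using s by (simp add: q_def distrib_left power2_commute)
  then have "?d \<le> sqrt s * sqrt q"
    by (metis real_le_rsqrt real_sqrt_mult)
  then have d: "?d * exp (- (ln q / 2)) \<le> sqrt s"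
    using q by (simp add: exp_minus ln_sqrt[symmetric] field_simps)
  have "ln (1 + \<eta>\<^sup>2 / s) \<le> ln q"
    using ln_quadratic_mono[of \<eta> "fst (p n) $ i - fst \<theta> $ i" s] False s \<eta> by (simp add: q_def)
  \<comment> \<open>The hypothesis \<open>1 \<le> real n * a n $ i\<close> makes the coefficient of
    the logarithm nonpositive, which reverses the inequality.\<close>
  then have e: "exp (- (real n * a n $ i - 1) / 2 * ln q) \<le> exp (- (real n * a n $ i - 1) / 2 * ln (1 + \<eta>\<^sup>2 / s))"
    using n(2) by (subst exp_le_cancel_iff) (rule mult_left_mono_neg, simp_all)
  have "a n $ i / 2 * ln q \<le> weighted_KL (a n) (p n) \<theta>"
    using weighted_KL_ge[of "a n" "p n" \<theta> "{i}"] n \<theta> by (auto simp: regular_def less_imp_le q_def s_def)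
  then have "likelihood_ratio n \<theta> \<le> exp (- real n * (a n $ i / 2 * ln q))"
    by (rule likelihood_ratio_le)
  also have "\<dots> = exp (- (ln q / 2)) * exp (- (real n * a n $ i - 1) / 2 * ln q)"
    by (simp add: mult_exp_exp field_simps)
  finally have "?d * likelihood_ratio n \<theta> \<le> ?d * (exp (- (ln q / 2)) * exp (- (real n * a n $ i - 1) / 2 * ln q))"
    by (rule mult_left_mono) simp
  also have "\<dots> = (?d * exp (- (ln q / 2))) * exp (- (real n * a n $ i - 1) / 2 * ln q)"
    by simp
  also have "\<dots> \<le> sqrt s * exp (- (real n * a n $ i - 1) / 2 * ln (1 + \<eta>\<^sup>2 / s))"
    by (rule mult_mono[OF d e]) (use s in auto)
  also have "\<dots> = ?B" by (simp add: s_def)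
  finally show ?thesis
    using mult_pos_pos[OF \<eta> likelihood_ratio_pos[of n \<theta>]] by linarith
qed

text \<open>Deviations up to \<open>\<eta>\<close> contribute at most \<open>\<eta>\<close> after
  normalisation. Larger ones contribute \<open>B n\<close>, which decays exponentially, while the
  normalising constant does not.\<close>

lemma posterior_expectation_tendsto:
  "(\<lambda>n. (\<integral>\<theta>. fst \<theta> $ i * likelihood_ratio n \<theta> \<partial>P) / mass n UNIV) \<longlonglongrightarrow> \<mu> $ i"
proof (rule tendstoI)
  fix e :: real assume "0 < e"
  \<comment> \<open>The three shares of \<open>e\<close> go to small deviations, to large
    deviations, and to the distance of the sample mean from the true mean.\<close>
  define \<eta> where "\<eta> = e / 3"
  have \<eta>: "0 < \<eta>" using \<open>0 < e\<close> by (simp add: \<eta>_def)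
  \<comment> \<open>Half the limiting decay rate of \<open>B\<close>, so that \<open>B n\<close>
    still vanishes after division by a normalising constant of at least
    \<open>exp (- n * \<delta>)\<close>.\<close>
  define \<delta> where "\<delta> = \<alpha> $ i / 4 * ln (1 + \<eta>\<^sup>2 / v $ i)"
  have \<delta>: "0 < \<delta>" using \<eta> v_pos[of i] \<alpha>_pos[of i] unfolding \<delta>_def by (intro mult_pos_pos ln_gt_zero) simp_all
  define B where "B n = sqrt (snd (p n) $ i) * exp (- (real n * a n $ i - 1) / 2 * ln (1 + \<eta>\<^sup>2 / snd (p n) $ i))" for n
  have coeff: "(\<lambda>n. \<delta> - (a n $ i - 1 / real n) / 2 * ln (1 + \<eta>\<^sup>2 / snd (p n) $ i))
      \<longlonglongrightarrow> \<delta> - (\<alpha> $ i - 0) / 2 * ln (1 + \<eta>\<^sup>2 / v $ i)"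
    using v_pos[of i] \<eta> by (intro tendsto_intros component_limits lim_1_over_n) (auto simp: add_pos_nonneg less_imp_neq[symmetric])
  have "\<delta> - (\<alpha> $ i - 0) / 2 * ln (1 + \<eta>\<^sup>2 / v $ i) = - \<delta>" by (simp add: \<delta>_def field_simps)
  with \<delta> have neg: "\<delta> - (\<alpha> $ i - 0) / 2 * ln (1 + \<eta>\<^sup>2 / v $ i) < 0" by linarith
  have "filterlim (\<lambda>n. (\<delta> - (a n $ i - 1 / real n) / 2 * ln (1 + \<eta>\<^sup>2 / snd (p n) $ i)) * real n) at_bot sequentially"
    by (rule filterlim_tendsto_neg_mult_at_bot[OF coeff neg filterlim_real_sequentially])
  then have "(\<lambda>n. exp ((\<delta> - (a n $ i - 1 / real n) / 2 * ln (1 + \<eta>\<^sup>2 / snd (p n) $ i)) * real n)) \<longlonglongrightarrow> 0"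
    by (rule filterlim_compose[OF exp_at_bot])
  then have "(\<lambda>n. sqrt (snd (p n) $ i) * exp ((\<delta> - (a n $ i - 1 / real n) / 2 * ln (1 + \<eta>\<^sup>2 / snd (p n) $ i)) * real n)) \<longlonglongrightarrow> sqrt (v $ i) * 0"
    by (intro tendsto_mult tendsto_real_sqrt component_limits)
  moreover have "\<forall>\<^sub>F n in sequentially. sqrt (snd (p n) $ i) * exp ((\<delta> - (a n $ i - 1 / real n) / 2 * ln (1 + \<eta>\<^sup>2 / snd (p n) $ i)) * real n) = B n * exp (real n * \<delta>)"
    using eventually_gt_at_top[of 0]
  proof eventually_elim
    case (elim n)
    then have "(\<delta> - (a n $ i - 1 / real n) / 2 * ln (1 + \<eta>\<^sup>2 / snd (p n) $ i)) * real n
        = - (real n * a n $ i - 1) / 2 * ln (1 + \<eta>\<^sup>2 / snd (p n) $ i) + real n * \<delta>"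
      by (simp add: field_simps)
    then show ?case by (simp only: B_def exp_add mult.assoc)
  qed
  ultimately have "(\<lambda>n. B n * exp (real n * \<delta>)) \<longlonglongrightarrow> 0"
    by (auto intro: Lim_transform_eventually)
  then have e1: "\<forall>\<^sub>F n in sequentially. B n * exp (real n * \<delta>) < \<eta>"
    using \<eta> by (rule order_tendstoD(2))
  have "filterlim (\<lambda>n. a n $ i * real n) at_top sequentially"
    by (rule filterlim_tendsto_pos_mult_at_top[OF component_limits(1) \<alpha>_pos filterlim_real_sequentially])
  then have e2: "\<forall>\<^sub>F n in sequentially. 1 \<le> a n $ i * real n"
    by (simp add: filterlim_at_top)
  have e3: "\<forall>\<^sub>F n in sequentially. dist (fst (p n) $ i) (\<mu> $ i) < \<eta>"
    by (rule tendstoD[OF component_limits(2) \<eta>])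
  from e1 e2 e3 eventually_regular mass_UNIV_lower[OF \<delta>]
  show "\<forall>\<^sub>F n in sequentially. dist ((\<integral>\<theta>. fst \<theta> $ i * likelihood_ratio n \<theta> \<partial>P) / mass n UNIV) (\<mu> $ i) < e"
  proof eventually_elim
    case (elim n)
    let ?m = "fst (p n) $ i"
    let ?Z = "mass n UNIV"
    have Z: "0 < ?Z" using elim(5) by (rule less_le_trans[rotated]) simp
    have [measurable]: "(\<lambda>\<theta>::'k param. fst \<theta> $ i) \<in> borel_measurable borel"
      by (intro borel_measurable_continuous_onI continuous_intros)
    have bound: "AE \<theta> in P. \<bar>fst \<theta> $ i - ?m\<bar> * likelihood_ratio n \<theta> \<le> \<eta> * likelihood_ratio n \<theta> + B n"
      using AE_param
      by eventually_elim (use deviation_likelihood_ratio_le[OF elim(4) _ _ \<eta>] elim(2) in \<open>simp add: B_def mult.commute\<close>)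
    have iR: "integrable P (likelihood_ratio n)"
      using integrable_likelihood_ratio[OF elim(4), of UNIV] by simp
    have iB: "integrable P (\<lambda>\<theta>. \<eta> * likelihood_ratio n \<theta> + B n)" using iR by simp
    \<comment> \<open>The same domination yields integrability of the first moment, even when the
      prior itself has no mean.\<close>
    have iD: "integrable P (\<lambda>\<theta>. (fst \<theta> $ i - ?m) * likelihood_ratio n \<theta>)"
    proof (rule Bochner_Integration.integrable_bound[OF iB])
      show "AE \<theta> in P. norm ((fst \<theta> $ i - ?m) * likelihood_ratio n \<theta>) \<le> norm (\<eta> * likelihood_ratio n \<theta> + B n)"
        using bound
      proof eventually_elim
        case (elim \<theta>)
        also have "\<eta> * likelihood_ratio n \<theta> + B n \<le> norm (\<eta> * likelihood_ratio n \<theta> + B n)" by simp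
        finally show ?case by (simp only: abs_mult real_norm_def abs_likelihood_ratio)
      qed
    qed measurable
    have Z_eq: "?Z = (\<integral>\<theta>. likelihood_ratio n \<theta> \<partial>P)" by (simp add: mass_def)
    have "(\<integral>\<theta>. fst \<theta> $ i * likelihood_ratio n \<theta> \<partial>P)
        = (\<integral>\<theta>. (fst \<theta> $ i - ?m) * likelihood_ratio n \<theta> + ?m * likelihood_ratio n \<theta> \<partial>P)"
      by (simp add: algebra_simps)
    also have "\<dots> = (\<integral>\<theta>. (fst \<theta> $ i - ?m) * likelihood_ratio n \<theta> \<partial>P) + ?m * ?Z"
      using iD iR by (simp add: Z_eq)
    finally have split: "(\<integral>\<theta>. fst \<theta> $ i * likelihood_ratio n \<theta> \<partial>P) / ?Z - ?m
        = (\<integral>\<theta>. (fst \<theta> $ i - ?m) * likelihood_ratio n \<theta> \<partial>P) / ?Z"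
      using Z by (simp add: field_simps)
    have "\<bar>\<integral>\<theta>. (fst \<theta> $ i - ?m) * likelihood_ratio n \<theta> \<partial>P\<bar>
        \<le> (\<integral>\<theta>. \<bar>fst \<theta> $ i - ?m\<bar> * likelihood_ratio n \<theta> \<partial>P)"
      using integral_abs_bound[of P "\<lambda>\<theta>. (fst \<theta> $ i - ?m) * likelihood_ratio n \<theta>"]
      by (simp add: abs_mult)
    also have "\<dots> \<le> (\<integral>\<theta>. \<eta> * likelihood_ratio n \<theta> + B n \<partial>P)"
      using integrable_abs[OF iD]
      by (intro integral_mono_AE[OF _ iB bound]) (simp add: abs_mult)
    also have "\<dots> = \<eta> * ?Z + B n" using iR by (simp add: Z_eq prob_space)
    finally have "\<bar>\<integral>\<theta>. (fst \<theta> $ i - ?m) * likelihood_ratio n \<theta> \<partial>P\<bar> / ?Z \<le> (\<eta> * ?Z + B n) / ?Z"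
      using Z by (intro divide_right_mono) auto
    also have "\<dots> = \<eta> + B n / ?Z" using Z by (simp add: add_divide_distrib)
    also have "B n / ?Z \<le> B n / exp (- real n * \<delta>)"
      using elim(4,5) by (intro divide_left_mono) (auto simp: B_def regular_def less_imp_le Z)
    also have "\<dots> = B n * exp (real n * \<delta>)" by (simp add: exp_minus divide_inverse)
    finally have "\<bar>(\<integral>\<theta>. fst \<theta> $ i * likelihood_ratio n \<theta> \<partial>P) / ?Z - ?m\<bar> \<le> \<eta> + B n * exp (real n * \<delta>)"
      using Z by (simp add: split)
    then show ?case
      using elim(1,3) unfolding dist_real_def \<eta>_def by linarith
  qed
qed

section \<open>Decay rate of the misordered mass\<close>

text \<open>A misordered pair costs at least \<open>R\<close> when measured at the true parameters.
  Replacing these by the fitted ones loses \<open>\<eta>\<close> in each logarithm and a factor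
  \<open>1 - \<eta>\<close> in the weights, uniformly over all parameters in
  \<open>A\<close>.\<close>

lemma mass_misorder_upper:
  fixes R :: real
  assumes best: "\<And>i. i \<noteq> b \<Longrightarrow> \<mu> $ i < \<mu> $ b"
    and R: "\<And>i. i \<noteq> b \<Longrightarrow> R \<le> rate \<mu> v b i (\<alpha> $ i) (\<alpha> $ b)" "0 \<le> R"
    and A: "A \<in> sets borel" "\<And>\<theta>. \<theta> \<in> A \<Longrightarrow> \<exists>i. i \<noteq> b \<and> fst \<theta> $ b \<le> fst \<theta> $ i"
    and \<delta>: "0 < \<delta>"
  shows "\<forall>\<^sub>F n in sequentially. mass n A \<le> exp (- real n * (R - \<delta>))"
proof -
  \<comment> \<open>Chosen so that \<open>\<eta> * (R + 1) \<le> \<delta>\<close>, hence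
    \<open>(1 - \<eta>) * (R - \<eta>) \<ge> R - \<delta>\<close>; the cap 1/2 keeps
    \<open>1 - \<eta>\<close> positive.\<close>
  define \<eta> where "\<eta> = min (1 / 2) (\<delta> / (R + 1))"
  have \<eta>: "0 < \<eta>" "\<eta> < 1" and "\<eta> \<le> \<delta> / (R + 1)" using \<delta> R(2) by (auto simp: \<eta>_def)
  then have "\<eta> * (R + 1) \<le> \<delta>" using R(2) by (simp add: pos_le_divide_eq)
  then have \<delta>': "R - \<delta> \<le> (1 - \<eta>) * (R - \<eta>)"
  proof -
    have "(1 - \<eta>) * (R - \<eta>) = R - \<eta> * (R + 1) + \<eta> * \<eta>" by (simp add: algebra_simps)
    with \<open>\<eta> * (R + 1) \<le> \<delta>\<close> zero_le_square[of \<eta>] show ?thesis by linarith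
  qed
  have "\<forall>\<^sub>F n in sequentially. \<forall>j. \<forall>\<phi>. ln (1 + (\<mu> $ j - \<phi>)\<^sup>2 / v $ j)
      \<le> \<eta> + ln (1 + (fst (p n) $ j - \<phi>)\<^sup>2 / snd (p n) $ j)"
    using eventually_ln_quadratic_le[OF component_limits(2,3) v_pos \<eta>(1)]
    by (intro eventually_all_finite) auto
  moreover have "\<forall>\<^sub>F n in sequentially. \<forall>j. (1 - \<eta>) * \<alpha> $ j < a n $ j"
  proof (intro eventually_all_finite order_tendstoD(1)[OF component_limits(1)])
    fix j show "(1 - \<eta>) * \<alpha> $ j < \<alpha> $ j" using \<alpha>_pos[of j] \<eta> by simp
  qed
  ultimately show ?thesis
    using eventually_regular
  proof eventually_elim
    case (elim n)
    show ?case
    proof (rule mass_upper[OF elim(3) A(1)])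
      fix \<theta> assume \<theta>: "\<theta> \<in> A" "\<theta> \<in> param_space"
      obtain i where i: "i \<noteq> b" "fst \<theta> $ b \<le> fst \<theta> $ i" using A(2)[OF \<theta>(1)] by blast
      define X where "X j = ln (1 + (\<mu> $ j - fst \<theta> $ j)\<^sup>2 / v $ j)" for j
      define Y where "Y j = ln (1 + (fst (p n) $ j - fst \<theta> $ j)\<^sup>2 / snd (p n) $ j)" for j
      have Y0: "0 \<le> Y j" for j using elim(3) by (auto simp: Y_def regular_def less_imp_le)
      have XY: "X j \<le> \<eta> + Y j" for j using elim(1) by (auto simp: X_def Y_def)
      \<comment> \<open>Since \<open>X j - \<eta>\<close> may be negative, the weight is enlarged
        only after passing to the nonnegative \<open>Y j\<close>.\<close>
      have each: "(1 - \<eta>) * (\<alpha> $ j / 2 * (X j - \<eta>)) \<le> a n $ j / 2 * Y j" for j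
      proof -
        have "(1 - \<eta>) * \<alpha> $ j / 2 * (X j - \<eta>) \<le> (1 - \<eta>) * \<alpha> $ j / 2 * Y j"
          using XY[of j] \<eta> \<alpha>_pos[of j] by (intro mult_left_mono) auto
        also have "\<dots> \<le> a n $ j / 2 * Y j"
          using elim(2) Y0 by (intro mult_right_mono divide_right_mono) (auto intro: less_imp_le)
        finally show ?thesis by (simp add: mult.assoc)
      qed
      have "R \<le> \<alpha> $ i / 2 * X i + \<alpha> $ b / 2 * X b"
        unfolding X_def
        by (rule order_trans[OF R(1)[OF i(1)] rate_le_crossing])
          (use v_pos \<alpha>_pos best[OF i(1)] i(2) in \<open>auto intro: less_imp_le\<close>)
      moreover have "\<alpha> $ i / 2 * \<eta> + \<alpha> $ b / 2 * \<eta> \<le> \<eta>"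
        using mult_right_mono[OF \<alpha>_le[of i] less_imp_le[OF \<eta>(1)]]
          mult_right_mono[OF \<alpha>_le[of b] less_imp_le[OF \<eta>(1)]] by linarith
      ultimately have "R - \<eta> \<le> \<alpha> $ i / 2 * (X i - \<eta>) + \<alpha> $ b / 2 * (X b - \<eta>)"
        by (simp only: right_diff_distrib)
      then have "(1 - \<eta>) * (R - \<eta>) \<le> (1 - \<eta>) * (\<alpha> $ i / 2 * (X i - \<eta>) + \<alpha> $ b / 2 * (X b - \<eta>))"
        using \<eta> by (intro mult_left_mono) auto
      also have "\<dots> \<le> (\<Sum>j\<in>{i, b}. a n $ j / 2 * Y j)"
        using add_mono[OF each[of i] each[of b]] i(1) by (simp add: distrib_left)
      also have "\<dots> \<le> weighted_KL (a n) (p n) \<theta>"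
        unfolding Y_def using elim(3) by (intro weighted_KL_ge \<theta>) (auto simp: regular_def less_imp_le)
      finally show "R - \<delta> \<le> weighted_KL (a n) (p n) \<theta>" using \<delta>' by linarith
    qed
  qed
qed

text \<open>The minimiser \<open>z\<close> ties the two means, so they are pulled slightly apart to
  \<open>z - \<eta>\<close> for \<open>b\<close> and \<open>z + \<eta>\<close> for \<open>i\<close>,
  which makes the misordering strict and hence open. All other means stay true and every variance is
  optimal; by continuity the extra cost is below \<open>\<delta>\<close> for small
  \<open>\<eta>\<close>.\<close>

lemma mass_misorder_lower:
  assumes i: "i \<noteq> b" "\<mu> $ i < \<mu> $ b"
    and A: "A \<in> sets borel" "{\<theta>. fst \<theta> $ b < fst \<theta> $ i} \<subseteq> A"
    and \<delta>: "0 < \<delta>"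
  shows "\<forall>\<^sub>F n in sequentially. exp (- real n * (rate \<mu> v b i (\<alpha> $ i) (\<alpha> $ b) + \<delta>)) \<le> mass n A"
proof -
  let ?R = "rate \<mu> v b i (\<alpha> $ i) (\<alpha> $ b)"
  obtain z where z: "\<mu> $ i \<le> z" "z \<le> \<mu> $ b" "?R = rate_objective \<mu> v b i (\<alpha> $ i) (\<alpha> $ b) z"
    by (rule rate_attained_between[OF v_pos \<alpha>_pos[THEN less_imp_le] \<alpha>_pos[THEN less_imp_le]
          less_imp_le[OF i(2)]])
  define g where "g \<eta> = \<alpha> $ i / 2 * ln (1 + (\<mu> $ i - (z + \<eta>))\<^sup>2 / v $ i)
    + \<alpha> $ b / 2 * ln (1 + (\<mu> $ b - (z - \<eta>))\<^sup>2 / v $ b)" for \<eta>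
  have nz: "1 + (\<mu> $ j - y)\<^sup>2 / v $ j \<noteq> 0" "v $ j \<noteq> 0" for j y
    using v_pos[of j] zero_le_power2[of "\<mu> $ j - y"] divide_nonneg_pos[of "(\<mu> $ j - y)\<^sup>2" "v $ j"] by linarith+
  have "(g \<longlongrightarrow> \<alpha> $ i / 2 * ln (1 + (\<mu> $ i - (z + 0))\<^sup>2 / v $ i)
    + \<alpha> $ b / 2 * ln (1 + (\<mu> $ b - (z - 0))\<^sup>2 / v $ b)) (at_right 0)"
    unfolding g_def by (intro tendsto_intros nz)
  then have "(g \<longlongrightarrow> ?R) (at_right 0)" by (simp add: z(3) rate_objective_def)
  then have "\<forall>\<^sub>F \<eta> in at_right 0. g \<eta> < ?R + \<delta>" using \<delta> by (intro order_tendstoD(2)) auto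
  moreover have "\<forall>\<^sub>F \<eta> in at_right 0. 0 < \<eta> \<and> \<eta> < \<epsilon>"
    using eventually_at_right_real[OF \<epsilon>(1)] by eventually_elim auto
  ultimately have "\<forall>\<^sub>F \<eta> in at_right 0. g \<eta> < ?R + \<delta> \<and> 0 < \<eta> \<and> \<eta> < \<epsilon>" by eventually_elim auto
  then obtain \<eta> where \<eta>: "g \<eta> < ?R + \<delta>" "0 < \<eta>" "\<eta> < \<epsilon>"
    using eventually_happens'[OF trivial_limit_at_right_real] by blast
  define \<phi> :: "real ^ 'k" where "\<phi> = (\<chi> j. if j = b then z - \<eta> else if j = i then z + \<eta> else \<mu> $ j)"
  define \<theta> where "\<theta> = (\<phi>, \<chi> j. v $ j + (\<mu> $ j - \<phi> $ j)\<^sup>2)"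
  have "weighted_KL \<alpha> (\<mu>, v) \<theta> = (\<Sum>j\<in>UNIV. \<alpha> $ j / 2 * ln (1 + (\<mu> $ j - \<phi> $ j)\<^sup>2 / v $ j))"
    using weighted_KL_optimal_variance[of "(\<mu>, v)" \<alpha> \<phi>] v_pos by (simp add: \<theta>_def)
  also have "\<dots> = (\<Sum>j\<in>{i, b}. \<alpha> $ j / 2 * ln (1 + (\<mu> $ j - \<phi> $ j)\<^sup>2 / v $ j))"
    by (rule sum.mono_neutral_right) (auto simp: \<phi>_def)
  also have "\<dots> = g \<eta>" using i(1) by (simp add: g_def \<phi>_def)
  finally have KL: "weighted_KL \<alpha> (\<mu>, v) \<theta> < ?R + \<delta>" using \<eta>(1) by simp
  let ?lo = "MIN j. \<mu> $ j" and ?hi = "MAX j. \<mu> $ j"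
  have \<mu>: "?lo \<le> \<mu> $ j" "\<mu> $ j \<le> ?hi" for j by (auto intro: Min_le Max_ge)
  have \<phi>: "?lo - \<epsilon> < \<phi> $ j" "\<phi> $ j < ?hi + \<epsilon>" "\<bar>\<mu> $ j - \<phi> $ j\<bar> \<le> ?hi - ?lo + 2 * \<epsilon>" for j
  proof -
    consider "j = b" "\<phi> $ j = z - \<eta>" | "j = i" "\<phi> $ j = z + \<eta>" | "\<phi> $ j = \<mu> $ j"
      using i(1) by (cases "j = b"; cases "j = i") (auto simp: \<phi>_def)
    then have "?lo - \<epsilon> < \<phi> $ j \<and> \<phi> $ j < ?hi + \<epsilon> \<and> \<bar>\<mu> $ j - \<phi> $ j\<bar> \<le> ?hi - ?lo + 2 * \<epsilon>"
      by cases (use \<mu>[of i] \<mu>[of b] \<mu>[of j] z \<eta> \<epsilon>(1) in linarith)+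
    then show "?lo - \<epsilon> < \<phi> $ j" "\<phi> $ j < ?hi + \<epsilon>" "\<bar>\<mu> $ j - \<phi> $ j\<bar> \<le> ?hi - ?lo + 2 * \<epsilon>"
      by blast+
  qed
  \<comment> \<open>The optimal variance exceeds \<open>v $ j\<close> by at most the squared range
    term in the upper edge of the prior core, since \<open>z\<close> lies between true means and
    \<open>\<eta> < \<epsilon>\<close>.\<close>
  have "\<theta> \<in> interior (prior_core \<mu> v \<epsilon>)"
  proof (rule interior_prior_coreI)
    fix j
    have v: "(MIN j. v $ j) \<le> v $ j" "v $ j \<le> (MAX j. v $ j)" by (auto intro: Min_le Max_ge)
    have snd: "snd \<theta> $ j = v $ j + (\<mu> $ j - \<phi> $ j)\<^sup>2" by (simp add: \<theta>_def)
    then show "(MIN j. v $ j) - \<epsilon> < snd \<theta> $ j"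
      using v \<epsilon>(1) zero_le_power2[of "\<mu> $ j - \<phi> $ j"] by linarith
    have "\<bar>\<mu> $ j - \<phi> $ j\<bar> \<le> \<bar>?hi - ?lo + 2 * \<epsilon>\<bar>" using \<phi>(3)[of j] by linarith
    then have "(\<mu> $ j - \<phi> $ j)\<^sup>2 \<le> (?hi - ?lo + 2 * \<epsilon>)\<^sup>2" by (simp only: abs_le_square_iff)
    then show "snd \<theta> $ j < (MAX j. v $ j) + \<epsilon> + (?hi - ?lo + 2 * \<epsilon>)\<^sup>2"
      using v \<epsilon>(1) snd by linarith
  qed (use \<phi> in \<open>auto simp: \<theta>_def\<close>)
  moreover have "open {\<theta>::'k param. fst \<theta> $ b < fst \<theta> $ i}"
    by (intro open_Collect_less continuous_intros)
  moreover have "\<theta> \<in> {\<theta>. fst \<theta> $ b < fst \<theta> $ i}"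
    using \<eta>(2) i(1) by (simp add: \<theta>_def \<phi>_def)
  ultimately show ?thesis
    by (intro mass_lower[OF A(1) _ A(2) _ _ KL])
qed

lemma misorder_rate:
  assumes "CARD('k) \<ge> 2" and best: "\<And>i. i \<noteq> b \<Longrightarrow> \<mu> $ i < \<mu> $ b"
  shows "(\<lambda>n. - (1 / real n) * ln (mass n {\<theta>. \<exists>i. i \<noteq> b \<and> fst \<theta> $ b \<le> fst \<theta> $ i} / mass n UNIV))
    \<longlonglongrightarrow> (MIN i\<in>UNIV - {b}. rate \<mu> v b i (\<alpha> $ i) (\<alpha> $ b))" (is "?f \<longlonglongrightarrow> ?R")
proof (rule tendstoI)
  fix e :: real assume e: "0 < e"
  \<comment> \<open>One \<open>\<delta>\<close> is lost on the misordered mass and one on the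
    normalising constant, so the total error \<open>2 * \<delta>\<close> stays below
    \<open>e\<close>.\<close>
  define \<delta> where "\<delta> = e / 3"
  have \<delta>: "0 < \<delta>" using e by (simp add: \<delta>_def)
  let ?A = "{\<theta>::'k param. \<exists>i. i \<noteq> b \<and> fst \<theta> $ b \<le> fst \<theta> $ i}"
  let ?rate = "\<lambda>i. rate \<mu> v b i (\<alpha> $ i) (\<alpha> $ b)"
  have ne: "UNIV - {b} \<noteq> {}"
  proof
    assume "UNIV - {b} = {}"
    then have "UNIV = {b}" by auto
    then have "CARD('k) = card {b}" by simp
    with assms(1) show False by simp
  qed
  \<comment> \<open>A design attaining the minimum supplies the lower bound: overtaking by this one
    competitor already misorders.\<close>
  have "?R \<in> ?rate ` (UNIV - {b})" using ne by (intro Min_in) auto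
  then obtain i where i: "i \<noteq> b" "?R = ?rate i" by auto
  have R_le: "?R \<le> ?rate j" if "j \<noteq> b" for j using that by (intro Min_le) auto
  have "0 \<le> ?rate i"
    unfolding rate_def rate_objective_def
    using \<alpha>_pos v_pos by (intro cINF_greatest add_nonneg_nonneg mult_nonneg_nonneg ln_ge_zero) (auto simp: less_imp_le)
  then have R0: "0 \<le> ?R" using i(2) by simp
  have "?A = (\<Union>i\<in>- {b}. {\<theta>. fst \<theta> $ b \<le> fst \<theta> $ i})" by auto
  also have "closed \<dots>"
    by (intro closed_UN ballI closed_Collect_le continuous_intros) simp
  finally have A: "?A \<in> sets borel" by simp
  have up: "\<forall>\<^sub>F n in sequentially. mass n ?A \<le> exp (- real n * (?R - \<delta>))"
    by (rule mass_misorder_upper[OF best R_le R0 A _ \<delta>]) auto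
  have lo: "\<forall>\<^sub>F n in sequentially. exp (- real n * (?R + \<delta>)) \<le> mass n ?A"
    unfolding i(2) by (rule mass_misorder_lower[OF i(1) best[OF i(1)] A _ \<delta>]) (use i(1) in \<open>auto intro: less_imp_le\<close>)
  from up lo eventually_regular mass_UNIV_lower[OF \<delta>]
  show "\<forall>\<^sub>F n in sequentially. dist (?f n) ?R < e"
  proof eventually_elim
    case (elim n)
    have n: "0 < real n" using elim(3) by (simp add: regular_def)
    have pos: "0 < mass n ?A" "0 < mass n UNIV"
      using elim(2,4) by (auto intro: less_le_trans[rotated])
    have "ln (mass n ?A) \<le> ln (exp (- real n * (?R - \<delta>)))"
      using elim(1) pos(1) by (subst ln_le_cancel_iff) auto
    then have "ln (mass n ?A) \<le> - real n * (?R - \<delta>)" by (simp only: ln_exp)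
    moreover have "- real n * (?R + \<delta>) \<le> ln (mass n ?A)" "- real n * \<delta> \<le> ln (mass n UNIV)"
      using elim(2,4) pos by (simp_all only: ln_ge_iff)
    moreover have "ln (mass n UNIV) \<le> 0"
      using pos mass_UNIV_le[OF elim(3)] by simp
    moreover note mult_pos_pos[OF n \<delta>]
    ultimately have "- ln (mass n ?A) + ln (mass n UNIV) - real n * ?R \<le> real n * (2 * \<delta>)"
      "- (real n * (2 * \<delta>)) \<le> - ln (mass n ?A) + ln (mass n UNIV) - real n * ?R"
      by (simp_all only: right_diff_distrib distrib_left mult_minus_left)
    then have "\<bar>- ln (mass n ?A / mass n UNIV) - real n * ?R\<bar> \<le> real n * (2 * \<delta>)"
      using pos by (simp add: ln_div abs_le_iff)
    then have "\<bar>- ln (mass n ?A / mass n UNIV) - real n * ?R\<bar> / real n \<le> 2 * \<delta>"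
      using n by (simp add: pos_divide_le_eq mult.commute)
    moreover have "dist (?f n) ?R = \<bar>- ln (mass n ?A / mass n UNIV) - real n * ?R\<bar> / real n"
    proof -
      have "?f n - ?R = (- ln (mass n ?A / mass n UNIV) - real n * ?R) / real n"
        using n by (simp add: field_simps)
      then show ?thesis using n by (simp only: dist_real_def abs_divide abs_of_nat)
    qed
    ultimately show ?case using e by (simp only: \<delta>_def)
  qed
qed

end

section \<open>The Bayesian probability of correct selection\<close>

text \<open>The indicator discards the values of \<open>\<pi>0\<close> outside the parameter space,
  where no sign is assumed.\<close>

definition prior_measure :: "('k::finite param \<Rightarrow> real) \<Rightarrow> 'k param measure" where
  "prior_measure \<pi>0 = density lborel (\<lambda>\<theta>. ennreal (indicator param_space \<theta> * \<pi>0 \<theta>))"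

context
  fixes \<pi>0 :: "'k::finite param \<Rightarrow> real"
  assumes prior_measurable: "set_borel_measurable borel param_space \<pi>0"
    and prior_nonneg: "\<And>\<theta>. \<theta> \<in> param_space \<Longrightarrow> 0 \<le> \<pi>0 \<theta>"
    and prior_integral: "(LINT \<theta>:param_space|lborel. \<pi>0 \<theta>) = 1"
begin

lemma measurable_prior_weight [measurable]:
  "(\<lambda>\<theta>. indicator param_space \<theta> * \<pi>0 \<theta>) \<in> borel_measurable borel"
  using prior_measurable by (simp add: set_borel_measurable_def)

lemma prior_weight_nonneg: "0 \<le> indicator param_space \<theta> * \<pi>0 \<theta>"
  using prior_nonneg by (simp add: indicator_def)

lemma prob_space_prior_measure: "prob_space (prior_measure \<pi>0)"
proof
  let ?w = "\<lambda>\<theta>. indicator param_space \<theta> * \<pi>0 \<theta>"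
  have one: "(\<integral>\<theta>. ?w \<theta> \<partial>lborel) = 1"
    using prior_integral by (simp add: set_lebesgue_integral_def)
  \<comment> \<open>A non-integrable function has Bochner integral 0, so the value 1 forces
    integrability.\<close>
  then have "integrable lborel ?w"
    using not_integrable_integral_eq by fastforce
  then have "(\<integral>\<^sup>+\<theta>. ennreal (?w \<theta>) \<partial>lborel) = 1"
    using one prior_weight_nonneg by (subst nn_integral_eq_integral) auto
  then show "emeasure (prior_measure \<pi>0) (space (prior_measure \<pi>0)) = 1"
    by (simp add: prior_measure_def emeasure_density)
qed

lemma AE_prior_measure_param_space: "AE \<theta> in prior_measure \<pi>0. \<theta> \<in> param_space"
proof -
  have w: "(\<lambda>\<theta>. ennreal (indicator param_space \<theta> * \<pi>0 \<theta>)) \<in> borel_measurable lborel"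
    by measurable
  show ?thesis
    unfolding prior_measure_def AE_density[OF w] by (auto simp: indicator_def)
qed

lemma measure_prior_measure_pos:
  assumes U: "open U" "U \<noteq> {}" and lower: "0 < c" "\<And>\<theta>. \<theta> \<in> U \<Longrightarrow> \<theta> \<in> param_space \<and> c \<le> \<pi>0 \<theta>"
  shows "0 < measure (prior_measure \<pi>0) U"
proof -
  interpret prob_space "prior_measure \<pi>0" by (rule prob_space_prior_measure)
  obtain \<theta> r where r: "0 < r" "ball \<theta> r \<subseteq> U"
    using U by (meson ex_in_conv open_contains_ball)
  have "0 < emeasure lborel (ball \<theta> r)"
    using content_ball_pos[OF r(1), of \<theta>] by (simp add: measure_def enn2real_positive_iff)
  also have "\<dots> \<le> emeasure lborel U" using U r(2) by (intro emeasure_mono) auto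
  finally have "0 < ennreal c * emeasure lborel U" using lower(1) by (simp add: ennreal_zero_less_mult_iff)
  also have "\<dots> = (\<integral>\<^sup>+\<theta>. ennreal c * indicator U \<theta> \<partial>lborel)"
    using U by (subst nn_integral_cmult_indicator) auto
  also have "\<dots> \<le> (\<integral>\<^sup>+\<theta>. ennreal (indicator param_space \<theta> * \<pi>0 \<theta>) * indicator U \<theta> \<partial>lborel)"
    using lower(2) by (intro nn_integral_mono) (auto simp: indicator_def intro!: ennreal_leI)
  also have "\<dots> = emeasure (prior_measure \<pi>0) U"
    using U by (simp add: prior_measure_def emeasure_density)
  finally show ?thesis by (simp add: emeasure_eq_measure)
qed

text \<open>Turns the set integrals that define the posterior quantities into prior expectations. If
  integrability fails, it fails on both sides and both default to 0.\<close>

lemma set_integral_prior_measure: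
  assumes [measurable]: "f \<in> borel_measurable borel"
    and "\<And>\<theta>. \<theta> \<in> param_space \<Longrightarrow> g \<theta> = \<pi>0 \<theta> * f \<theta>"
  shows "(LINT \<theta>:param_space|lborel. g \<theta>) = (\<integral>\<theta>. f \<theta> \<partial>prior_measure \<pi>0)"
proof -
  have "(LINT \<theta>:param_space|lborel. g \<theta>) = (\<integral>\<theta>. (indicator param_space \<theta> * \<pi>0 \<theta>) *\<^sub>R f \<theta> \<partial>lborel)"
    unfolding set_lebesgue_integral_def
    using assms(2) by (intro Bochner_Integration.integral_cong refl) (auto simp: indicator_def)
  also have "\<dots> = (\<integral>\<theta>. f \<theta> \<partial>prior_measure \<pi>0)"
    unfolding prior_measure_def
    using prior_weight_nonneg by (subst integral_density) auto
  finally show ?thesis .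
qed

text \<open>The pathwise form of the result, for a fixed data array \<open>x\<close>; the randomness
  of the observations enters only through \<open>stats\<close>.\<close>

lemma PCS_B_rate:
  fixes \<mu> v :: "real ^ 'k" and N :: "nat \<Rightarrow> 'k \<Rightarrow> nat" and x :: "'k \<Rightarrow> nat \<Rightarrow> real"
  assumes k: "CARD('k) \<ge> 2"
    and variances: "\<And>i. v $ i > 0"
    and best: "\<And>i. i \<noteq> b \<Longrightarrow> \<mu> $ i < \<mu> $ b"
    and eps: "0 < \<epsilon>" "\<epsilon> < (MIN j. v $ j) / 2"
    and prior_lower: "0 < c" "\<And>\<theta>. \<theta> \<in> prior_core \<mu> v \<epsilon> \<Longrightarrow> c \<le> \<pi>0 \<theta>"
    and alpha: "\<And>i. \<alpha> i > 0" "\<And>i. \<alpha> i \<le> 1"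
    and proportions: "\<And>i. (\<lambda>n. real (N n i) / real n) \<longlonglongrightarrow> \<alpha> i"
    and stats: "(\<lambda>n. sample_stats (N n) x) \<longlonglongrightarrow> (\<mu>, v)"
  shows "(\<lambda>n. - (1 / real n) * ln (1 - PCS_B \<pi>0 (N n) x))
    \<longlonglongrightarrow> (MIN i\<in>UNIV - {b}. rate \<mu> v b i (\<alpha> i) (\<alpha> b))"
proof -
  let ?P = "prior_measure \<pi>0"
  define a :: "nat \<Rightarrow> real ^ 'k" where "a n = (\<chi> i. real (N n i) / real n)" for n
  define p where "p n = sample_stats (N n) x" for n
  interpret prob_space ?P by (rule prob_space_prior_measure)
  interpret concentrating_posterior ?P \<mu> v "\<chi> i. \<alpha> i" \<epsilon> a p
  proof unfold_locales
    show "sets ?P = sets borel" by (simp add: prior_measure_def)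
    show "0 < measure ?P U" if "open U" "U \<noteq> {}" "U \<subseteq> prior_core \<mu> v \<epsilon>" for U
      by (rule measure_prior_measure_pos[OF that(1,2) prior_lower(1)])
        (use prior_core_subset_param_space[OF eps] prior_lower(2) that(3) in blast)
    show "a \<longlonglongrightarrow> (\<chi> i. \<alpha> i)" unfolding a_def[abs_def] by (intro tendsto_vec_lambda proportions)
    show "p \<longlonglongrightarrow> (\<mu>, v)" unfolding p_def[abs_def] by (rule stats)
  qed (use eps in \<open>simp_all add: AE_prior_measure_param_space variances alpha\<close>)
  have [measurable]: "(\<lambda>\<theta>::'k param. fst \<theta> $ i) \<in> borel_measurable borel" for i
    by (intro borel_measurable_continuous_onI continuous_intros)
  let ?A = "{\<theta>::'k param. \<exists>i. i \<noteq> b \<and> fst \<theta> $ b \<le> fst \<theta> $ i}"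
  let ?mean = "\<lambda>n i. (\<integral>\<theta>. fst \<theta> $ i * likelihood_ratio n \<theta> \<partial>?P) / mass n UNIV"
  \<comment> \<open>The likelihood at the fitted parameter is a positive constant common to
    numerator and normaliser, so it cancels.\<close>
  have posterior_eq: "posterior \<pi>0 (N n) x \<theta> = \<pi>0 \<theta> * (likelihood_ratio n \<theta> / mass n UNIV)"
    if n: "regular n" and \<theta>: "\<theta> \<in> param_space" for n \<theta>
  proof -
    let ?L = "likelihood (N n) x"
    have "0 < N n i" for i
      using n by (auto simp: regular_def a_def) (metis gr0I less_irrefl of_nat_0 divide_eq_0_iff)
    moreover have s: "0 < snd (p n) $ i" for i using n by (simp add: regular_def)
    ultimately have L: "?L \<theta> = ?L (p n) * likelihood_ratio n \<theta>" if "\<theta> \<in> param_space" for \<theta>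
      unfolding likelihood_ratio_def a_def p_def
      using n that by (intro likelihood_eq_weighted_KL) (auto simp: p_def regular_def)
    have "(LINT \<theta>':param_space|lborel. \<pi>0 \<theta>' * ?L \<theta>') = (\<integral>\<theta>'. ?L (p n) * likelihood_ratio n \<theta>' \<partial>?P)"
      by (rule set_integral_prior_measure) (auto simp: L)
    also have "\<dots> = ?L (p n) * mass n UNIV" by (simp add: mass_def)
    finally show ?thesis
      using likelihood_pos[of "p n" "N n" x] s by (simp add: posterior_def L[OF \<theta>])
  qed
  have mean_eq: "posterior_mean \<pi>0 (N n) x i = ?mean n i" if "regular n" for n i
  proof -
    have "posterior_mean \<pi>0 (N n) x i = (\<integral>\<theta>. fst \<theta> $ i * likelihood_ratio n \<theta> / mass n UNIV \<partial>?P)"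
      unfolding posterior_mean_def
      by (rule set_integral_prior_measure) (use that in \<open>auto simp: posterior_eq\<close>)
    then show ?thesis by simp
  qed
  \<comment> \<open>Correct selection asks for strict inequalities, so ties belong to the
    complement; hence the weak inequality in \<open>?A\<close>.\<close>
  have PCS_eq: "1 - PCS_B \<pi>0 (N n) x = mass n ?A / mass n UNIV"
    if n: "regular n" and sel: "selected_design \<pi>0 (N n) x = b" and Z: "0 < mass n UNIV" for n
  proof -
    let ?W = "{\<theta>::'k param. \<forall>i. i \<noteq> b \<longrightarrow> fst \<theta> $ i < fst \<theta> $ b}"
    have A: "?A = (\<Union>i\<in>- {b}. {\<theta>. fst \<theta> $ b \<le> fst \<theta> $ i})" by auto
    have "closed ?A"
      unfolding A by (intro closed_UN ballI closed_Collect_le continuous_intros) simp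
    moreover have W: "?W = - ?A" by (auto simp: not_le)
    ultimately have [measurable]: "?A \<in> sets borel" "?W \<in> sets borel" by auto
    have "PCS_B \<pi>0 (N n) x = (\<integral>\<theta>. indicator ?W \<theta> * likelihood_ratio n \<theta> / mass n UNIV \<partial>?P)"
      unfolding PCS_B_def sel Let_def
      by (rule set_integral_prior_measure) (use n in \<open>auto simp: posterior_eq\<close>)
    also have "\<dots> = mass n ?W / mass n UNIV" by (simp add: mass_def)
    also have "mass n ?W = mass n UNIV - mass n ?A"
    proof -
      have "mass n ?W + mass n ?A
          = (\<integral>\<theta>. indicator ?W \<theta> * likelihood_ratio n \<theta> + indicator ?A \<theta> * likelihood_ratio n \<theta> \<partial>?P)"
        unfolding mass_def using n
        by (intro Bochner_Integration.integral_add[symmetric] integrable_likelihood_ratio) auto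
      also have "\<dots> = mass n UNIV"
        unfolding mass_def W by (intro Bochner_Integration.integral_cong) (auto simp: indicator_def)
      finally show ?thesis by simp
    qed
    finally show ?thesis using Z by (simp add: field_simps)
  qed
  have "\<forall>\<^sub>F n in sequentially. \<forall>i. i \<noteq> b \<longrightarrow> ?mean n i < ?mean n b"
  proof (intro eventually_all_finite)
    fix i
    show "\<forall>\<^sub>F n in sequentially. i \<noteq> b \<longrightarrow> ?mean n i < ?mean n b"
    proof (cases "i = b")
      case False
      have "\<forall>\<^sub>F n in sequentially. 0 < ?mean n b - ?mean n i"
        using best[OF False]
        by (intro order_tendstoD(1)[OF tendsto_diff[OF posterior_expectation_tendsto[of b] posterior_expectation_tendsto[of i]]]) simp
      then show ?thesis by eventually_elim simp
    qed simp
  qed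
  with eventually_regular mass_UNIV_lower[OF zero_less_one]
  have "\<forall>\<^sub>F n in sequentially. - (1 / real n) * ln (mass n ?A / mass n UNIV)
      = - (1 / real n) * ln (1 - PCS_B \<pi>0 (N n) x)"
  proof eventually_elim
    case (elim n)
    let ?f = "posterior_mean \<pi>0 (N n) x"
    have less: "?f i < ?f b" if "i \<noteq> b" for i
      using elim(3) that by (simp add: mean_eq[OF elim(1)])
    \<comment> \<open>This only fixes the maximal value; the strict gap to every other design then
      forces the choice made by \<open>arg_max\<close> to be \<open>b\<close>.\<close>
    have "?f (arg_max ?f (\<lambda>_. True)) = ?f b"
      by (rule arg_max_equality) (use less in \<open>force intro: less_imp_le\<close>)+
    with less have "selected_design \<pi>0 (N n) x = b"
      unfolding selected_design_def by (metis less_irrefl)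
    moreover have "0 < mass n UNIV" using elim(2) by (rule less_le_trans[rotated]) simp
    ultimately show ?case using PCS_eq[OF elim(1)] by simp
  qed
  moreover have "(\<lambda>n. - (1 / real n) * ln (mass n ?A / mass n UNIV))
      \<longlonglongrightarrow> (MIN i\<in>UNIV - {b}. rate \<mu> v b i (\<alpha> i) (\<alpha> b))"
    using misorder_rate[OF k best] by simp
  ultimately show ?thesis by (rule Lim_transform_eventually[rotated])
qed

end

section \<open>From the strong law to almost every sample path\<close>

lemma sample_stats_tendsto:
  fixes N :: "nat \<Rightarrow> 'k::finite \<Rightarrow> nat" and \<mu> v :: "real ^ 'k"
  assumes N: "\<And>i. filterlim (\<lambda>n. N n i) at_top sequentially"
    and mean: "\<And>i. (\<lambda>m. (\<Sum>l<m. x i l) / real m) \<longlonglongrightarrow> \<mu> $ i"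
    and square: "\<And>i. (\<lambda>m. (\<Sum>l<m. (x i l)\<^sup>2) / real m) \<longlonglongrightarrow> v $ i + (\<mu> $ i)\<^sup>2"
  shows "(\<lambda>n. sample_stats (N n) x) \<longlonglongrightarrow> (\<mu>, v)"
proof -
  note mean' = filterlim_compose[OF mean N] and square' = filterlim_compose[OF square N]
  have "(\<lambda>n. \<chi> i. (\<Sum>l<N n i. x i l) / real (N n i)) \<longlonglongrightarrow> (\<chi> i. \<mu> $ i)"
    by (intro tendsto_vec_lambda mean')
  moreover have "(\<lambda>n. \<chi> i. (\<Sum>l<N n i. (x i l)\<^sup>2) / real (N n i) - ((\<Sum>l<N n i. x i l) / real (N n i))\<^sup>2)
      \<longlonglongrightarrow> (\<chi> i. (v $ i + (\<mu> $ i)\<^sup>2) - (\<mu> $ i)\<^sup>2)"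
    by (intro tendsto_vec_lambda tendsto_diff square' tendsto_power mean')
  ultimately show ?thesis
    unfolding sample_stats_def by (intro tendsto_Pair) (simp_all add: vec_lambda_eta)
qed

theorem theorem1:
  fixes M :: "'w measure"
    and X :: "'k::finite \<Rightarrow> nat \<Rightarrow> 'w \<Rightarrow> real"
    and \<mu> v :: "real ^ 'k"
    and best :: 'k
    and \<pi>0 :: "'k param \<Rightarrow> real"
    and c_upper c_lower \<epsilon> :: real
    and \<alpha> :: "'k \<Rightarrow> real"
    and N :: "nat \<Rightarrow> 'k \<Rightarrow> nat"
  assumes k: "CARD('k) \<ge> 2"
    and variances: "\<And>i. v $ i > 0"
    and best: "\<And>i. i \<noteq> best \<Longrightarrow> \<mu> $ i < \<mu> $ best"
    and prob: "prob_space M"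
    and indep: "prob_space.indep_vars M (\<lambda>_. borel) (\<lambda>(i, l). X i l) UNIV"
    and normal: "\<And>i l. distributed M lborel (X i l) (normal_density (\<mu> $ i) (sqrt (v $ i)))"
    and prior_measurable: "set_borel_measurable borel param_space \<pi>0"
    and prior_nonneg: "\<And>\<theta>. \<theta> \<in> param_space \<Longrightarrow> 0 \<le> \<pi>0 \<theta>"
    and prior_integral: "(LINT \<theta>:param_space|lborel. \<pi>0 \<theta>) = 1"
    and prior_upper: "c_upper > 0" "\<And>\<theta>. \<theta> \<in> param_space \<Longrightarrow> \<pi>0 \<theta> \<le> c_upper"
    and eps: "0 < \<epsilon>" "\<epsilon> < (MIN j. v $ j) / 2"
    and prior_lower: "c_lower > 0" "\<And>\<theta>. \<theta> \<in> prior_core \<mu> v \<epsilon> \<Longrightarrow> c_lower \<le> \<pi>0 \<theta>"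
    and alpha: "\<And>i. \<alpha> i > 0" "(\<Sum>i\<in>UNIV. \<alpha> i) = 1"
    and budget: "\<And>n. (\<Sum>i\<in>UNIV. N n i) = n"
    and proportions: "\<And>i. (\<lambda>n. real (N n i) / real n) \<longlonglongrightarrow> \<alpha> i"
  shows "AE \<omega> in M.
    (\<lambda>n. - (1 / real n) * ln (1 - PCS_B \<pi>0 (N n) (\<lambda>i l. X i l \<omega>)))
      \<longlonglongrightarrow> (MIN i\<in>UNIV - {best}. rate \<mu> v best i (\<alpha> i) (\<alpha> best))"
proof -
  interpret prob_space M by (rule prob)
  \<comment> \<open>A positive limiting proportion gives every design unboundedly many samples, so
    limits in the sample size carry over to limits in the budget.\<close>
  have N_lim: "filterlim (\<lambda>n. N n i) at_top sequentially" for i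
  proof -
    have "filterlim (\<lambda>n. real (N n i) / real n * real n) at_top sequentially"
      by (rule filterlim_tendsto_pos_mult_at_top[OF proportions alpha(1) filterlim_real_sequentially])
    moreover have "\<forall>\<^sub>F n in sequentially. real (N n i) / real n * real n = real (N n i)"
      using eventually_gt_at_top[of 0] by eventually_elim simp
    ultimately have "filterlim (\<lambda>n. real (N n i)) at_top sequentially"
      by (simp add: filterlim_cong)
    then show ?thesis by (simp add: filterlim_sequentially_iff_filterlim_real)
  qed
  have alpha_le: "\<alpha> i \<le> 1" for i
    using member_le_sum[of i UNIV \<alpha>] alpha by (simp add: less_imp_le)
  have "AE \<omega> in M. (\<lambda>m. (\<Sum>l<m. X i l \<omega>) / real m) \<longlonglongrightarrow> \<mu> $ i \<and>
      (\<lambda>m. (\<Sum>l<m. (X i l \<omega>)\<^sup>2) / real m) \<longlonglongrightarrow> v $ i + (\<mu> $ i)\<^sup>2" for i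
    \<comment> \<open>The injection \<open>\<lambda>l. (i, l)\<close> picks the samples of design
      \<open>i\<close> out of the jointly independent family.\<close>
    using strong_law_normal[OF indep, of "\<lambda>l. (i, l)" "\<mu> $ i" "sqrt (v $ i)"] normal variances[of i]
    by (simp add: inj_on_def)
  then have "AE \<omega> in M. \<forall>i\<in>UNIV. (\<lambda>m. (\<Sum>l<m. X i l \<omega>) / real m) \<longlonglongrightarrow> \<mu> $ i \<and>
      (\<lambda>m. (\<Sum>l<m. (X i l \<omega>)\<^sup>2) / real m) \<longlonglongrightarrow> v $ i + (\<mu> $ i)\<^sup>2"
    by (intro AE_finite_allI) auto
  then show ?thesis
  proof eventually_elim
    case (elim \<omega>)
    then have "(\<lambda>n. sample_stats (N n) (\<lambda>i l. X i l \<omega>)) \<longlonglongrightarrow> (\<mu>, v)"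
      by (intro sample_stats_tendsto N_lim) auto
    then show ?case
      by (intro PCS_B_rate[OF prior_measurable prior_nonneg prior_integral k variances best eps
            prior_lower alpha(1) alpha_le proportions])
  qed
qed

end
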